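(* Let $V$ be a $d\times d$ matrix weight on $\mathbb{R}^n$ with $V\in\mathcal{ND}$. The following are equivalent: (a) $V\in\mathcal{A}_{2,\infty}$; (b) $V\in\mathcal{A}_\infty$; (c) $V\in\mathcal{R}_{\mathrm{BM}}$ and $(\det V)^{1/d}$ belongs to the scalar class $\mathrm{A}_\infty$.
   Context: A matrix weight is a (complex) Hermitian positive semidefinite $d\times d$ measurable matrix function $V$ on $\mathbb{R}^n$ with $|V|\in L^1_{loc}(\mathbb{R}^n)$. Inequalities between Hermitian matrices are in the sense of quadratic forms; cubes are axis-parallel. $V\in\mathcal{ND}$: $\int_EV$ is positive definite for every measurable $E$ with $|E|>0$. $V\in\mathcal{A}_{2,\infty}$: there is $A_V>0$ with $\det\big(\frac1{|Q|}\int_QV\big)\le A_V\exp\big(\frac1{|Q|}\int_Q\ln\det V(x)\,dx\big)$ for all cubes $Q$. $V\in\mathcal{A}_\infty$: for every $\epsilon>0$ there is $\delta>0$ such that for every cube $Q$, $\big|\{x\in Q:V(x)\ge\delta\frac1{|Q|}\int_QV(y)\,dy\}\big|\ge(1-\epsilon)|Q|$. $V\in\mathcal{R}_{\mathrm{BM}}$ (reverse Brunn–Minkowski class): there is $B_V>0$ with $\big(\det\frac1{|Q|}\int_QV\big)^{1/d}\le B_V\frac1{|Q|}\int_Q[\det V(x)]^{1/d}dx$ for all cubes $Q$. Scalar $\mathrm{A}_\infty$ is the classical Muckenhoupt class (the case $d=1$ of $\mathcal{A}_\infty$). *)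

theory Defs
  imports "HOL-Analysis.Analysis"
begin

section \<open>Hermitian matrices\<close>

definition hermitian :: "complex^'d^'d \<Rightarrow> bool" where
  "hermitian A \<longleftrightarrow> (\<forall>i j. A $ i $ j = cnj (A $ j $ i))"

text \<open>On \<^typ>\<open>complex^'d\<close> the library's real inner product is the real part of the
  standard Hermitian inner product, so for Hermitian \<open>A\<close> the value of the quadratic form of
  \<open>A\<close> at \<open>v\<close> is \<open>v \<bullet> (A *v v)\<close>.\<close>

lemma hermitian_quadratic_form:
  fixes A :: "complex^'d^'d"
  assumes "hermitian A"
  shows "(\<Sum>i\<in>UNIV. \<Sum>j\<in>UNIV. cnj (v $ i) * A $ i $ j * v $ j) = complex_of_real (v \<bullet> (A *v v))"
proof -
  let ?S = "\<Sum>i\<in>UNIV. \<Sum>j\<in>UNIV. cnj (v $ i) * A $ i $ j * v $ j"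
  have c: "v $ i * cnj (A $ i $ j) * cnj (v $ j) = cnj (v $ j) * A $ j $ i * v $ i" for i j
  proof -
    have "cnj (A $ i $ j) = A $ j $ i"
      using assms unfolding hermitian_def by metis
    then show ?thesis by (simp only: mult.commute mult.left_commute)
  qed
  have "cnj ?S = (\<Sum>i\<in>UNIV. \<Sum>j\<in>UNIV. v $ i * cnj (A $ i $ j) * cnj (v $ j))"
    by (simp only: cnj_sum complex_cnj_mult complex_cnj_cnj)
  also have "\<dots> = (\<Sum>i\<in>UNIV. \<Sum>j\<in>UNIV. cnj (v $ j) * A $ j $ i * v $ i)"
    by (simp only: c)
  also have "\<dots> = ?S"
    by (rule sum.swap)
  finally have "cnj ?S = ?S" .
  then have "?S \<in> \<real>"
    by (simp only: Reals_cnj_iff)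
  then have "?S = complex_of_real (Re ?S)"
    by (simp only: of_real_Re)
  moreover have "Re ?S = v \<bullet> (A *v v)"
  proof -
    have i: "x \<bullet> y = Re (cnj x * y)" for x y :: complex
      by (simp add: inner_complex_def)
    have "v \<bullet> (A *v v) = (\<Sum>i\<in>UNIV. Re (cnj (v $ i) * (\<Sum>j\<in>UNIV. A $ i $ j * v $ j)))"
      by (simp only: inner_vec_def matrix_vector_mult_def vec_lambda_beta i)
    also have "\<dots> = Re ?S"
      by (simp only: sum_distrib_left Re_sum mult.assoc)
    finally show ?thesis ..
  qed
  ultimately show ?thesis by (simp only:)
qed

definition pos_semidef :: "complex^'d^'d \<Rightarrow> bool" where
  "pos_semidef A \<longleftrightarrow> hermitian A \<and> (\<forall>v. 0 \<le> v \<bullet> (A *v v))"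

definition pos_def :: "complex^'d^'d \<Rightarrow> bool" where
  "pos_def A \<longleftrightarrow> hermitian A \<and> (\<forall>v. v \<noteq> 0 \<longrightarrow> 0 < v \<bullet> (A *v v))"

definition form_le :: "complex^'d^'d \<Rightarrow> complex^'d^'d \<Rightarrow> bool" where
  "form_le A B \<longleftrightarrow> (\<forall>v. v \<bullet> (A *v v) \<le> v \<bullet> (B *v v))"

text \<open>The determinant of a Hermitian matrix is real; \<open>rdet\<close> is that real number.\<close>

definition rdet :: "complex^'d^'d \<Rightarrow> real" where
  "rdet A = Re (det A)"

lemma hermitian_det:
  fixes A :: "complex^'d^'d"
  assumes "hermitian A"
  shows "det A = complex_of_real (rdet A)"
proof -
  have tr: "transpose A = (\<chi> i j. cnj (A $ i $ j))"
  proof -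
    have "cnj (A $ i $ j) = A $ j $ i" for i j
      using assms unfolding hermitian_def by metis
    then show ?thesis by (simp only: transpose_def)
  qed
  have "cnj (det A) = det (transpose A)"
    by (simp only: det_def tr cnj_sum cnj_prod complex_cnj_mult vec_lambda_beta complex_cnj_of_int)
  then have "cnj (det A) = det A"
    by (simp only: det_transpose)
  then have "det A \<in> \<real>"
    by (simp only: Reals_cnj_iff)
  then show ?thesis
    by (simp only: rdet_def of_real_Re)
qed


section \<open>Cubes and averages\<close>

definition cube :: "(real^'n) set \<Rightarrow> bool" where
  "cube Q \<longleftrightarrow> (\<exists>a l. 0 < l \<and> Q = cbox a (\<chi> i. a $ i + l))"

definition average :: "(real^'n) set \<Rightarrow> (real^'n \<Rightarrow> 'b::{banach, second_countable_topology}) \<Rightarrow> 'b" where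
  "average Q f = (1 / measure lebesgue Q) *\<^sub>R (LINT x:Q|lebesgue. f x)"

text \<open>For a matrix weight the integral of \<open>ln (det V)\<close> over a cube is finite or \<open>-\<infinity>\<close>, with
  \<open>ln 0 = -\<infinity>\<close> and \<open>exp (-\<infinity>) = 0\<close>. The library's conventions (\<open>ln 0 = 0\<close>, integral \<open>0\<close> for
  non-integrable functions) would give a different condition, so these are extended-real valued.\<close>

definition ext_ln :: "real \<Rightarrow> ereal" where
  "ext_ln t = (if 0 < t then ereal (ln t) else -\<infinity>)"

definition ext_exp :: "ereal \<Rightarrow> ereal" where
  "ext_exp t = (if t = \<infinity> then \<infinity> else if t = -\<infinity> then 0 else ereal (exp (real_of_ereal t)))"

definition ext_average :: "(real^'n) set \<Rightarrow> (real^'n \<Rightarrow> ereal) \<Rightarrow> ereal" where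
  "ext_average Q f =
     (enn2ereal (\<integral>\<^sup>+x\<in>Q. e2ennreal (f x) \<partial>lebesgue) - enn2ereal (\<integral>\<^sup>+x\<in>Q. e2ennreal (- f x) \<partial>lebesgue))
       / ereal (measure lebesgue Q)"


section \<open>Matrix weights\<close>

text \<open>Here \<^const>\<open>norm\<close> is the Frobenius norm; as all norms on matrices are equivalent,
  local integrability does not depend on this choice.\<close>

definition matrix_weight :: "(real^'n \<Rightarrow> complex^'d^'d) \<Rightarrow> bool" where
  "matrix_weight V \<longleftrightarrow>
     (\<forall>x. pos_semidef (V x)) \<and>
     V \<in> borel_measurable lebesgue \<and>
     (\<forall>K. compact K \<longrightarrow> set_integrable lebesgue K (\<lambda>x. norm (V x)))"

text \<open>A set \<open>E\<close> of infinite measure may have \<open>\<integral>\<^sub>E V\<close> infinite, in which case the Bochner integral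
  is \<open>0\<close> by convention. Restricting to \<open>E\<close> on which \<open>V\<close> is integrable loses nothing: every
  \<open>E\<close> of positive measure contains a bounded subset of positive measure, and the quadratic
  forms of the integrals increase with \<open>E\<close>.\<close>

definition class_ND :: "(real^'n \<Rightarrow> complex^'d^'d) \<Rightarrow> bool" where
  "class_ND V \<longleftrightarrow>
     (\<forall>E \<in> sets lebesgue. 0 < emeasure lebesgue E \<longrightarrow> set_integrable lebesgue E V \<longrightarrow>
        pos_def (LINT x:E|lebesgue. V x))"

definition class_A2inf :: "(real^'n \<Rightarrow> complex^'d^'d) \<Rightarrow> bool" where
  "class_A2inf V \<longleftrightarrow>
     (\<exists>A::real. 0 < A \<and> (\<forall>Q. cube Q \<longrightarrow>
        ereal (rdet (average Q V)) \<le> ereal A * ext_exp (ext_average Q (\<lambda>x. ext_ln (rdet (V x))))))"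

definition class_Ainf :: "(real^'n \<Rightarrow> complex^'d^'d) \<Rightarrow> bool" where
  "class_Ainf V \<longleftrightarrow>
     (\<forall>\<epsilon>::real. 0 < \<epsilon> \<longrightarrow> (\<exists>\<delta>::real. 0 < \<delta> \<and> (\<forall>Q. cube Q \<longrightarrow>
        (1 - \<epsilon>) * measure lebesgue Q
          \<le> measure lebesgue {x \<in> Q. form_le (\<delta> *\<^sub>R average Q V) (V x)})))"

definition class_RBM :: "(real^'n \<Rightarrow> complex^'d^'d) \<Rightarrow> bool" where
  "class_RBM V \<longleftrightarrow>
     (\<exists>B::real. 0 < B \<and> (\<forall>Q. cube Q \<longrightarrow>
        rdet (average Q V) powr (1 / CARD('d))
          \<le> B * average Q (\<lambda>x. rdet (V x) powr (1 / CARD('d)))))"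

definition scalar_weight :: "(real^'n \<Rightarrow> real) \<Rightarrow> bool" where
  "scalar_weight w \<longleftrightarrow>
     (\<forall>x. 0 \<le> w x) \<and>
     w \<in> borel_measurable lebesgue \<and>
     (\<forall>K. compact K \<longrightarrow> set_integrable lebesgue K w)"

definition scalar_Ainf :: "(real^'n \<Rightarrow> real) \<Rightarrow> bool" where
  "scalar_Ainf w \<longleftrightarrow>
     scalar_weight w \<and>
     (\<forall>\<epsilon>::real. 0 < \<epsilon> \<longrightarrow> (\<exists>\<delta>::real. 0 < \<delta> \<and> (\<forall>Q. cube Q \<longrightarrow>
        (1 - \<epsilon>) * measure lebesgue Q
          \<le> measure lebesgue {x \<in> Q. \<delta> * average Q w \<le> w x})))"

end

theory Submission
  imports Defs
begin

text \<open>The implications proved are (b) to (c), (c) to (a) and (a) to (b). Write \<open>M\<close> for the average of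
  \<open>V\<close> over a cube \<open>Q\<close>; it is positive definite because \<open>V\<close> lies in \<open>ND\<close>. Throughout, the matrix
  problem on \<open>Q\<close> is normalised by a change of basis \<open>C\<close> that makes \<open>C\<^sup>* M C\<close> comparable to the identity
  with constants that depend only on the dimension \<open>d\<close>. Such a \<open>C\<close> is found by maximising \<open>|det C|\<close> over
  matrices with columns in the ellipsoid of \<open>M\<close> (an Auerbach basis); it plays the part of the
  inverse square root of \<open>M\<close>. The linear functional
  \<open>\<tau>(V) = tr (C\<^sup>* V C)\<close> then has average at most \<open>d\<close> over \<open>Q\<close>, and three dimensional-constant comparisons hold:
  \<open>det V \<lesssim> det M \<cdot> \<tau>(V)\<^sup>d\<close>; \<open>V \<ge> \<delta> M\<close> implies \<open>det V \<gtrsim> \<delta>\<^sup>d det M\<close>; and \<open>V \<gtrsim> (det V / det M) \<tau>(V)\<^sup>1\<^sup>-\<^sup>d M\<close>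
  (\<open>rdet_le_rtrace_compress\<close>, \<open>rdet_ge_of_form_le\<close>, \<open>form_le_of_rdet\<close>).

  From (b) to (c): the second comparison bounds \<open>w = (det V)\<^sup>1\<^sup>/\<^sup>d\<close> from below by a multiple of \<open>(det M)\<^sup>1\<^sup>/\<^sup>d\<close> on
  most of \<open>Q\<close>. Averaging gives the reverse Brunn--Minkowski inequality, and since the first comparison
  bounds the average of \<open>w\<close> above by a multiple of \<open>(det M)\<^sup>1\<^sup>/\<^sup>d\<close>, the scalar condition follows too.

  From (c) to (a): only the scalar weight \<open>w\<close> matters, and what is needed is that the average of
  \<open>ln (w\<^sub>Q / w)\<close> over \<open>Q\<close> is bounded. The scalar condition is used once, with \<open>\<epsilon> = 2\<^sup>-\<^sup>n / 4\<close>. Stopping at the maximal dyadic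
  subcubes on which the average of \<open>w\<close> drops below \<open>(\<delta>/2) w\<^sub>Q\<close> selects at most half of \<open>Q\<close>; by doubling the
  averages on the selected cubes are still at least \<open>(\<delta>\<^sup>2/4) w\<^sub>Q\<close>; and off them \<open>w\<close> is not small,
  up to a null set. Iterating gives geometric decay of the measure of \<open>{w < (\<delta>\<^sup>2/4)\<^sup>k w\<^sub>Q}\<close>
  (\<open>low_set_decay\<close>), and summing over \<open>k\<close> bounds the logarithm (\<open>nn_integral_log_deficit\<close>).

  From (a) to (b): the first comparison shows that \<open>ln (det V / det M)\<close> is bounded above by
  \<open>const + d \<tau>(V)\<close>, whose average is bounded, while (a) bounds the average of
  \<open>ln (det V / det M)\<close> below. By Markov's inequality \<open>\<tau>(V)\<close> is bounded above and \<open>det V / det M\<close> below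
  on most of \<open>Q\<close>, and the third comparison turns this into \<open>V \<ge> \<delta> M\<close>.\<close>

section \<open>Half-open cubes and dyadic cells\<close>

text \<open>Half-open cubes tile exactly, so the stopped families below are disjoint
  and not just non-overlapping; they differ from closed cubes by null sets.\<close>

definition hcube :: "real^'n \<Rightarrow> real \<Rightarrow> (real^'n) set" where
  "hcube a l = {x. \<forall>i. a $ i \<le> x $ i \<and> x $ i < a $ i + l}"

lemma hcube_between: "box a (\<chi> i. a $ i + l) \<subseteq> hcube a l" "hcube a l \<subseteq> cbox a (\<chi> i. a $ i + l)"
  by (auto simp: hcube_def mem_box_cart less_imp_le)

lemma hcube_sym_diff_null: "sym_diff (hcube a l) (cbox a (\<chi> i. a $ i + l)) \<in> null_sets lebesgue"
proof -
  have "negligible (cbox a (\<chi> i. a $ i + l) - hcube a l)"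
    by (rule negligible_subset[OF negligible_frontier_interval]) (use hcube_between[of a l] in blast)
  moreover have "sym_diff (hcube a l) (cbox a (\<chi> i. a $ i + l)) = cbox a (\<chi> i. a $ i + l) - hcube a l"
    using hcube_between(2)[of a l] by blast
  ultimately show ?thesis by (simp add: negligible_iff_null_sets)
qed

lemma lmeasurable_hcube [measurable]: "hcube a l \<in> lmeasurable"
  using lmeasurable_negligible_symdiff[of "cbox a (\<chi> i. a $ i + l)" "hcube a l"] hcube_sym_diff_null[of a l]
  by (simp add: negligible_iff_null_sets Un_commute)

lemma sets_hcube [measurable, simp]: "hcube a l \<in> sets lebesgue"
  using lmeasurable_hcube by blast

lemma measure_hcube_cbox: "measure lebesgue (hcube a l) = measure lebesgue (cbox a (\<chi> i. a $ i + l))"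
  by (intro measure_negligible_symdiff) (use hcube_sym_diff_null[of a l] in \<open>simp_all add: negligible_iff_null_sets Un_commute\<close>)

lemma measure_hcube:
  fixes a :: "real^'n"
  assumes "0 < l"
  shows "measure lebesgue (hcube a l) = l ^ CARD('n)"
proof -
  have "cbox a (\<chi> i. a $ i + l) \<noteq> {}" using assms by (simp add: interval_ne_empty_cart)
  then have "measure lebesgue (cbox a (\<chi> i. a $ i + l)) = (\<Prod>i\<in>UNIV. (\<chi> i. a $ i + l) $ i - a $ i)"
    by (simp add: content_cbox_cart)
  then show ?thesis by (simp add: measure_hcube_cbox)
qed

text \<open>The level-\<open>k\<close> dyadic cell of \<open>x\<close> in the grid generated by \<open>hcube a l\<close>. As a class of the equivalence relation
  ``equal integer parts'', it makes disjointness and nestedness of cells immediate, and the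
  grid covers the whole space without reference to index vectors.\<close>

definition dcell :: "real^'n \<Rightarrow> real \<Rightarrow> nat \<Rightarrow> real^'n \<Rightarrow> (real^'n) set" where
  "dcell a l k x = {y. \<forall>i. \<lfloor>2 ^ k * (y $ i - a $ i) / l\<rfloor> = \<lfloor>2 ^ k * (x $ i - a $ i) / l\<rfloor>}"

lemma dcell_refl [simp]: "x \<in> dcell a l k x"
  by (simp add: dcell_def)

lemma dcell_eq: "y \<in> dcell a l k x \<Longrightarrow> dcell a l k y = dcell a l k x"
  by (simp add: dcell_def)

lemma dcell_antimono:
  assumes "j \<le> k" shows "dcell a l k x \<subseteq> dcell a l j x"
proof -
  have "dcell a l (Suc k) x \<subseteq> dcell a l k x" for k
  proof
    fix y assume y: "y \<in> dcell a l (Suc k) x"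
    have half: "\<lfloor>2 ^ k * t / l\<rfloor> = \<lfloor>2 ^ Suc k * t / l\<rfloor> div 2" for t :: real
      using floor_divide_real_eq_div[of 2 "2 ^ Suc k * t / l"] by simp
    from y show "y \<in> dcell a l k x"
      unfolding dcell_def mem_Collect_eq half by simp
  qed
  then show ?thesis by (rule lift_Suc_antimono_le[of "\<lambda>k. dcell a l k x", OF _ assms])
qed

lemma dcell_eq_hcube:
  assumes "0 < l"
  shows "dcell a l k x = hcube (\<chi> i. a $ i + (l / 2 ^ k) * of_int \<lfloor>2 ^ k * (x $ i - a $ i) / l\<rfloor>) (l / 2 ^ k)"
proof -
  have "\<lfloor>2 ^ k * (t - b) / l\<rfloor> = m \<longleftrightarrow> b + l / 2 ^ k * of_int m \<le> t \<and> t < b + l / 2 ^ k * of_int m + l / 2 ^ k"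
    for t b :: real and m :: int
    using assms by (simp add: floor_eq_iff field_simps)
  then show ?thesis unfolding dcell_def hcube_def by simp
qed

lemma dcell_0:
  assumes "0 < l" "x \<in> hcube a l" shows "dcell a l 0 x = hcube a l"
proof -
  have "\<lfloor>2 ^ 0 * (x $ i - a $ i) / l\<rfloor> = 0" for i
    using assms by (simp add: hcube_def floor_eq_iff field_simps)
  then show ?thesis using dcell_eq_hcube[OF assms(1), of a 0 x] by simp
qed

lemma lmeasurable_dcell [measurable]: "0 < l \<Longrightarrow> dcell a l k x \<in> lmeasurable"
  by (simp add: dcell_eq_hcube lmeasurable_hcube)

lemma dcell_small:
  fixes a :: "real^'n"
  assumes "0 < l" "open U" "x \<in> U"
  obtains k where "dcell a l k x \<subseteq> U"
proof -
  obtain e where e: "0 < e" "ball x e \<subseteq> U" using assms open_contains_ball by blast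
  define n where "n = real CARD('n)"
  have n: "0 < n" by (simp add: n_def)
  obtain k where k: "n * l / e < 2 ^ k" using real_arch_pow[of 2 "n * l / e"] by auto
  have "y \<in> ball x e" if y: "y \<in> dcell a l k x" for y
  proof -
    have c: "\<bar>x $ i - y $ i\<bar> \<le> l / 2 ^ k" for i
    proof -
      have "x \<in> dcell a l k x" by simp
      then show ?thesis using y unfolding dcell_eq_hcube[OF assms(1)] hcube_def mem_Collect_eq
        by (smt (verit) vec_lambda_beta)
    qed
    have "norm (x - y) \<le> (\<Sum>i\<in>UNIV. \<bar>(x - y) $ i\<bar>)" by (rule norm_le_l1_cart)
    also have "\<dots> \<le> (\<Sum>i\<in>(UNIV::'n set). l / 2 ^ k)" by (rule sum_mono) (use c in simp)
    also have "\<dots> = n * l / 2 ^ k" by (simp add: n_def)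
    also have "\<dots> < e" using k e by (simp add: field_simps)
    finally show ?thesis by (simp add: dist_norm)
  qed
  then show thesis using that e by blast
qed

text \<open>The maximal cells that satisfy \<open>P\<close> and meet \<open>X\<close>. The first level at which the cell of \<open>x\<close> satisfies \<open>P\<close> is
  the same for all points of that cell, hence the family is disjoint.\<close>

definition stopped :: "real^'n \<Rightarrow> real \<Rightarrow> ((real^'n) set \<Rightarrow> bool) \<Rightarrow> (real^'n) set \<Rightarrow> (real^'n) set set" where
  "stopped a l P X = {dcell a l (LEAST k. P (dcell a l k x)) x | x. x \<in> X \<and> (\<exists>k. P (dcell a l k x))}"

lemma stopped_cover: "x \<in> X \<Longrightarrow> P (dcell a l k x) \<Longrightarrow> x \<in> \<Union>(stopped a l P X)"
  unfolding stopped_def using dcell_refl by blast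

lemma stopped_cases:
  assumes "D \<in> stopped a l P X"
  obtains x k where "x \<in> X" "D = dcell a l k x" "P D" "\<And>j. j < k \<Longrightarrow> \<not> P (dcell a l j x)"
proof -
  from assms obtain x where x: "x \<in> X" "\<exists>k. P (dcell a l k x)"
    "D = dcell a l (LEAST k. P (dcell a l k x)) x" unfolding stopped_def by blast
  show thesis
    by (rule that[OF x(1,3)]) (use x LeastI_ex[OF x(2)] not_less_Least in auto)
qed

lemma stopped_disjoint: "disjoint (stopped a l P X)"
proof (rule disjointI)
  fix D D' assume DD: "D \<in> stopped a l P X" "D' \<in> stopped a l P X" "D \<noteq> D'"
  obtain x k where x: "x \<in> X" "D = dcell a l k x" "P D" "\<And>j. j < k \<Longrightarrow> \<not> P (dcell a l j x)"
    using stopped_cases[OF DD(1)] by metis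
  obtain y m where y: "y \<in> X" "D' = dcell a l m y" "P D'" "\<And>j. j < m \<Longrightarrow> \<not> P (dcell a l j y)"
    using stopped_cases[OF DD(2)] by metis
  show "D \<inter> D' = {}"
  proof (rule ccontr)
    assume "D \<inter> D' \<noteq> {}"
    then obtain z where z: "z \<in> dcell a l k x" "z \<in> dcell a l m y" using x y by blast
    have zx: "dcell a l j z = dcell a l j x" if "j \<le> k" for j
      using dcell_antimono[OF that] z(1) dcell_eq by blast
    have zy: "dcell a l j z = dcell a l j y" if "j \<le> m" for j
      using dcell_antimono[OF that] z(2) dcell_eq by blast
    have "k = m"
      by (metis linorder_neqE_nat order_refl less_imp_le x(2-4) y(2-4) zx zy)
    then show False using zx[of k] zy[of k] x y DD by simp
  qed
qed

lemma stopped_countable: "countable (stopped a l P X)"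
proof -
  have "stopped a l P X \<subseteq> range (\<lambda>(k, m :: int^'a). {y. \<forall>i. \<lfloor>2 ^ k * (y $ i - a $ i) / l\<rfloor> = m $ i})"
  proof
    fix D assume "D \<in> stopped a l P X"
    then obtain x k where "D = dcell a l k x" by (metis stopped_cases)
    then have "D = (\<lambda>(k, m :: int^'a). {y. \<forall>i. \<lfloor>2 ^ k * (y $ i - a $ i) / l\<rfloor> = m $ i})
       (k, \<chi> i. \<lfloor>2 ^ k * (x $ i - a $ i) / l\<rfloor>)"
      by (simp add: dcell_def)
    then show "D \<in> range (\<lambda>(k, m :: int^'a). {y. \<forall>i. \<lfloor>2 ^ k * (y $ i - a $ i) / l\<rfloor> = m $ i})"
      by blast
  qed
  then show ?thesis by (rule countable_subset) (rule countableI_type[THEN countable_image])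
qed

lemma stopped_sets: "0 < l \<Longrightarrow> D \<in> stopped a l P X \<Longrightarrow> D \<in> lmeasurable"
  by (metis stopped_cases lmeasurable_dcell)

lemma emeasure_le_over_partition:
  assumes F: "countable F" "disjoint F" "F \<subseteq> sets M" and EH: "E \<in> sets M" "H \<in> sets M"
    and cov: "E \<subseteq> \<Union>F" and le: "\<And>D. D \<in> F \<Longrightarrow> emeasure M (E \<inter> D) \<le> c * emeasure M (H \<inter> D)"
  shows "emeasure M E \<le> c * emeasure M H"
proof -
  have sum: "emeasure M (\<Union>D\<in>F. A \<inter> D) = (\<integral>\<^sup>+D. emeasure M (A \<inter> D) \<partial>count_space F)" if "A \<in> sets M" for A
    by (rule emeasure_UN_countable)
       (use F that in \<open>auto simp: disjoint_family_on_def disjoint_def\<close>)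
  have "emeasure M E = emeasure M (\<Union>D\<in>F. E \<inter> D)"
    using cov by (metis Int_Union inf.absorb1)
  also have "\<dots> \<le> (\<integral>\<^sup>+D. c * emeasure M (H \<inter> D) \<partial>count_space F)"
    unfolding sum[OF EH(1)] by (rule nn_integral_mono) (use le in simp)
  also have "\<dots> = c * emeasure M (\<Union>D\<in>F. H \<inter> D)"
    unfolding sum[OF EH(2)] by (rule nn_integral_cmult) simp
  also have "\<dots> \<le> c * emeasure M H"
    by (intro mult_left_mono emeasure_mono) (use EH in auto)
  finally show ?thesis .
qed

text \<open>A density argument along dyadic cells: a set \<open>G\<close> of positive
  measure has an open neighbourhood of less than twice its measure, and the maximal
  dyadic cells inside it would all be at most one quarter full.\<close>

lemma null_if_thin_in_cells:
  fixes a :: "real^'n"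
  assumes l: "0 < l" and G: "G \<in> lmeasurable"
    and thin: "\<And>x k. x \<in> G \<Longrightarrow> measure lebesgue (G \<inter> dcell a l k x) \<le> measure lebesgue (dcell a l k x) / 4"
  shows "measure lebesgue G = 0"
proof (rule ccontr)
  assume "measure lebesgue G \<noteq> 0"
  then have pos: "0 < measure lebesgue G" by (simp add: zero_less_measure_iff)
  have Gs: "G \<in> sets lebesgue" using G by blast
  obtain U where U: "open U" "G \<subseteq> U" "U - G \<in> lmeasurable"
    "emeasure lebesgue (U - G) < ennreal (measure lebesgue G)"
    using sets_lebesgue_outer_open[OF Gs pos] by blast
  have Um: "U \<in> lmeasurable"
    using fmeasurable.Un[OF U(3) G] U(2) by (simp add: Un_absorb2)
  have Ule: "measure lebesgue U < 2 * measure lebesgue G"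
  proof -
    have "measure lebesgue (U - G) < measure lebesgue G"
      using U(3,4) pos by (simp add: emeasure_eq_measure2 ennreal_less_iff)
    moreover have "measure lebesgue U = measure lebesgue (U - G) + measure lebesgue G"
      by (metis Diff_partition G U(2,3) Un_commute Diff_disjoint measure_Un3 Int_commute
          Un_Diff_cancel add.right_neutral diff_zero measure_empty sup.absorb_iff2)
    ultimately show ?thesis by simp
  qed
  let ?F = "stopped a l (\<lambda>D. D \<subseteq> U) G"
  have "emeasure lebesgue G \<le> ennreal (1/4) * emeasure lebesgue U"
  proof (rule emeasure_le_over_partition[of ?F])
    show "?F \<subseteq> sets lebesgue" using stopped_sets[OF l] by blast
    show "G \<subseteq> \<Union>?F"
    proof
      fix x assume x: "x \<in> G"
      then obtain k where "dcell a l k x \<subseteq> U" using dcell_small[OF l U(1)] U(2) by blast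
      then show "x \<in> \<Union>?F" using stopped_cover[of x G "\<lambda>D. D \<subseteq> U"] x by blast
    qed
    fix D assume D: "D \<in> ?F"
    obtain x k where x: "x \<in> G" "D = dcell a l k x" "D \<subseteq> U" using stopped_cases[OF D] by metis
    have Dm: "D \<in> lmeasurable" using stopped_sets[OF l D] .
    have "emeasure lebesgue (G \<inter> D) = measure lebesgue (G \<inter> D)"
      using fmeasurable.Int[OF G Dm] by (simp add: emeasure_eq_measure2)
    also have "\<dots> \<le> ennreal (1/4 * measure lebesgue D)"
      using thin[OF x(1), of k] x(2) by (intro ennreal_leI) simp
    also have "\<dots> = ennreal (1/4) * emeasure lebesgue (U \<inter> D)"
      using x(3) Dm by (subst ennreal_mult) (auto simp: emeasure_eq_measure2 Int_absorb1)
    finally show "emeasure lebesgue (G \<inter> D) \<le> ennreal (1/4) * emeasure lebesgue (U \<inter> D)" .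
  qed (use Gs Um stopped_countable stopped_disjoint in auto)
  then have "measure lebesgue G \<le> 1/4 * measure lebesgue U"
    using G Um by (simp add: emeasure_eq_measure2 flip: ennreal_mult)
  then show False using Ule pos by simp
qed

section \<open>Decay of the low sets of a scalar weight\<close>

lemma set_markov_inequality:
  fixes w :: "'a \<Rightarrow> real"
  assumes w: "w \<in> borel_measurable M" "\<And>x. 0 \<le> w x" and int: "set_integrable M D w"
    and Dm: "D \<in> fmeasurable M" and t: "0 \<le> t"
  shows "t * measure M {x \<in> D. t \<le> w x} \<le> (LINT x:D|M. w x)"
proof -
  have D: "D \<in> sets M" "emeasure M D < \<infinity>" using Dm by (auto simp: fmeasurable_def)
  have sub: "D \<subseteq> space M" using D sets.sets_into_space by blast
  have T: "{x \<in> D. t \<le> w x} \<in> sets M"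
  proof -
    have "{x \<in> D. t \<le> w x} = D \<inter> {x \<in> space M. t \<le> w x}" using sub by blast
    then show ?thesis using D w by simp
  qed
  have eT: "emeasure M {x \<in> D. t \<le> w x} < \<infinity>"
  proof -
    have "emeasure M {x \<in> D. t \<le> w x} \<le> emeasure M D" by (rule emeasure_mono) (use D in auto)
    then show ?thesis using D(2) by (rule le_less_trans)
  qed
  have "t * measure M {x \<in> D. t \<le> w x} = (LINT x:{x \<in> D. t \<le> w x}|M. t)"
    using T eT by (simp add: set_integral_const)
  also have "\<dots> \<le> (LINT x:D|M. w x)"
    unfolding set_lebesgue_integral_def
  proof (rule integral_mono)
    show "integrable M (\<lambda>x. indicator {x \<in> D. t \<le> w x} x *\<^sub>R t)"
      using T eT by (intro integrable_scaleR_left integrable_real_indicator)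
    show "integrable M (\<lambda>x. indicator D x *\<^sub>R w x)" using int by (simp only: set_integrable_def)
  qed (use w t in \<open>auto simp: indicator_def\<close>)
  finally show ?thesis .
qed

lemma mass_eq_average:
  fixes w :: "real^'n \<Rightarrow> real"
  assumes "0 < measure lebesgue D"
  shows "(LINT x:D|lebesgue. w x) = average D w * measure lebesgue D"
  using assms by (simp add: average_def)

lemma lmeasurable_less_set:
  fixes w :: "real^'n \<Rightarrow> real"
  assumes "w \<in> borel_measurable lebesgue" "D \<in> lmeasurable" shows "{x \<in> D. w x < t} \<in> lmeasurable"
proof -
  have "{x \<in> D. w x < t} = D \<inter> {x \<in> space lebesgue. w x < t}" by auto
  moreover have "{x \<in> space lebesgue. w x < t} \<in> sets lebesgue"
    using borel_measurable_iff_less[THEN iffD1, OF assms(1)] by (rule spec)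
  ultimately show ?thesis using assms(2) by (simp only: fmeasurable_Int_fmeasurable)
qed

lemma lmeasurable_ge_set:
  fixes w :: "real^'n \<Rightarrow> real"
  assumes "w \<in> borel_measurable lebesgue" "D \<in> lmeasurable" shows "{x \<in> D. t \<le> w x} \<in> lmeasurable"
proof -
  have "{x \<in> D. t \<le> w x} = D \<inter> {x \<in> space lebesgue. t \<le> w x}" by auto
  moreover have "{x \<in> space lebesgue. t \<le> w x} \<in> sets lebesgue"
    using borel_measurable_iff_ge[THEN iffD1, OF assms(1)] by (rule spec)
  ultimately show ?thesis using assms(2) by (simp only: fmeasurable_Int_fmeasurable)
qed

lemma measure_split_at_level:
  fixes w :: "real^'n \<Rightarrow> real"
  assumes "w \<in> borel_measurable lebesgue" "D \<in> lmeasurable"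
  shows "measure lebesgue D = measure lebesgue {x \<in> D. w x < t} + measure lebesgue {x \<in> D. t \<le> w x}"
proof -
  have eq: "{x \<in> D. t \<le> w x} = D - {x \<in> D. w x < t}" by auto
  have "measure lebesgue (D - {x \<in> D. w x < t}) = measure lebesgue D - measure lebesgue {x \<in> D. w x < t}"
    by (rule measurable_measure_Diff[OF assms(2) fmeasurableD[OF lmeasurable_less_set[OF assms]]]) blast
  then show ?thesis unfolding eq by simp
qed

lemma average_nonneg:
  fixes w :: "real^'n \<Rightarrow> real"
  assumes "\<And>x. 0 \<le> w x" shows "0 \<le> average D w"
proof -
  have "0 \<le> (LINT x:D|lebesgue. w x)"
    unfolding set_lebesgue_integral_def by (rule Bochner_Integration.integral_nonneg) (simp add: assms)
  then show ?thesis by (simp add: average_def)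
qed

text \<open>The scalar \<open>A\<^sub>\<infinity>\<close> condition for a single \<open>\<epsilon>\<close>: a quarter of the relative size of a dyadic
  child. This gives both doubling and the smallness of the stopped set.\<close>

context
  fixes w :: "real^'n \<Rightarrow> real" and \<delta> :: real
  assumes meas: "w \<in> borel_measurable lebesgue" and nonneg: "\<And>x. 0 \<le> w x"
    and int: "\<And>a l. 0 < l \<Longrightarrow> set_integrable lebesgue (hcube a l) w"
    and \<delta>: "0 < \<delta>" "\<delta> \<le> 1"
    and thin: "\<And>a l. 0 < l \<Longrightarrow> measure lebesgue {x \<in> hcube a l. w x < \<delta> * average (hcube a l) w}
        \<le> measure lebesgue (hcube a l) / (4 * 2 ^ CARD('n))"
begin

lemmas low_set_measurable = lmeasurable_less_set[OF meas]
lemmas split_at_level = measure_split_at_level[OF meas]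
lemmas average_nonneg_w = average_nonneg[of w, OF nonneg]

text \<open>Doubling: the exceptional set of the parent is at most a quarter of the child, so \<open>w\<close> is at least
  \<open>\<delta>\<close> times the average of the parent on three quarters of the child.\<close>

lemma average_half_cube:
  assumes "0 < l" "hcube b (l / 2) \<subseteq> hcube a l"
  shows "\<delta> / 2 * average (hcube a l) w \<le> average (hcube b (l / 2)) w"
proof -
  define P where "P = hcube a l"
  define D where "D = hcube b (l / 2)"
  have DP: "D \<subseteq> P" using assms by (simp add: D_def P_def)
  have mP: "measure lebesgue P = 2 ^ CARD('n) * measure lebesgue D"
    using assms by (simp add: P_def D_def measure_hcube power_divide)
  have Dpos: "0 < measure lebesgue D" using assms by (simp add: D_def measure_hcube)
  have Dm: "D \<in> lmeasurable" "P \<in> lmeasurable" by (simp_all add: D_def P_def lmeasurable_hcube)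
  let ?t = "\<delta> * average P w"
  have t: "0 \<le> ?t" using \<delta> average_nonneg_w by simp
  have "measure lebesgue {x \<in> D. w x < ?t} \<le> measure lebesgue {x \<in> P. w x < ?t}"
    by (rule measure_mono_fmeasurable) (use DP low_set_measurable Dm in auto)
  also have "\<dots> \<le> measure lebesgue P / (4 * 2 ^ CARD('n))" using thin[OF assms(1), of a] by (simp add: P_def)
  also have "\<dots> = measure lebesgue D / 4" using mP by simp
  finally have "measure lebesgue D / 2 \<le> measure lebesgue {x \<in> D. ?t \<le> w x}"
    using split_at_level[OF Dm(1), of ?t] Dpos by simp
  then have "?t * (measure lebesgue D / 2) \<le> ?t * measure lebesgue {x \<in> D. ?t \<le> w x}"
    using t by (rule mult_left_mono)
  also have "\<dots> \<le> (LINT x:D|lebesgue. w x)"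
    using set_markov_inequality[OF meas nonneg int[of "l/2" b] lmeasurable_hcube t] assms
    by (simp add: D_def)
  also have "\<dots> = average D w * measure lebesgue D" by (rule mass_eq_average[OF Dpos])
  finally have "(\<delta> / 2 * average P w) * measure lebesgue D \<le> average D w * measure lebesgue D"
    by (simp add: algebra_simps)
  then show ?thesis using Dpos unfolding P_def[symmetric] D_def[symmetric] by (rule mult_right_le_imp_le)
qed

text \<open>One step of the induction stops at the maximal dyadic subcubes \<open>D\<close> with average at most \<open>(\<delta>/2) w\<^sub>Q\<close>. They occupy
  at most half of \<open>Q\<close>, and the induction hypothesis applies to each of them because by doubling
  a level \<open>(\<delta>\<^sup>2/4)\<^sup>k\<^sup>+\<^sup>1 w\<^sub>Q\<close> is at most \<open>(\<delta>\<^sup>2/4)\<^sup>k w\<^sub>D\<close>.\<close>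

lemma low_set_decay:
  assumes "0 < l"
  shows "measure lebesgue {x \<in> hcube a l. w x < (\<delta>\<^sup>2 / 4) ^ k * average (hcube a l) w}
       \<le> measure lebesgue (hcube a l) / 2 ^ k"
  using assms
proof (induction k arbitrary: a l)
  case 0
  have "measure lebesgue {x \<in> hcube a l. w x < t} \<le> measure lebesgue (hcube a l)" for t
    using measure_mono_fmeasurable[OF _ fmeasurableD[OF low_set_measurable[OF lmeasurable_hcube]] lmeasurable_hcube,
        of a l t] by blast
  then show ?case by simp
next
  case (Suc k)
  define Q where "Q = hcube a l"
  define m where "m = average Q w"
  define \<kappa> where "\<kappa> = \<delta>\<^sup>2 / 4"
  define \<gamma> where "\<gamma> = \<delta> / 2"
  have \<kappa>: "0 < \<kappa>" "\<kappa> \<le> 1" "\<kappa> = \<gamma> * (\<delta> / 2)" "\<kappa> < \<delta> * \<gamma>"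
    using \<delta> power_le_one[of \<delta> 2] by (auto simp: \<kappa>_def \<gamma>_def power2_eq_square)
  have \<gamma>: "0 < \<gamma>" "\<gamma> < 1" using \<delta> by (auto simp: \<gamma>_def)
  have Qm: "Q \<in> lmeasurable" by (simp add: Q_def lmeasurable_hcube)
  note l = Suc.prems
  show ?case
  proof (cases "m = 0")
    case True
    then have "{x \<in> hcube a l. w x < (\<delta>\<^sup>2 / 4) ^ Suc k * average (hcube a l) w} = {}"
      using nonneg by (auto simp: m_def Q_def not_less)
    then show ?thesis by (simp only: measure_empty) (simp add: Q_def)
  next
    case False
    then have m: "0 < m" using average_nonneg_w[of Q] by (simp add: m_def)
    let ?P = "\<lambda>D. average D w \<le> \<gamma> * m"
    define F where "F = stopped a l ?P Q"
    define S where "S = \<Union>F"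
    define E where "E = {x \<in> Q. w x < \<kappa> ^ Suc k * m}"
    have F: "countable F" "disjoint F" "F \<subseteq> lmeasurable"
      using stopped_countable stopped_disjoint stopped_sets[OF l] by (auto simp: F_def)
    have stop: "\<exists>b s. 0 < s \<and> D = hcube b s \<and> D \<subseteq> Q \<and> average D w \<le> \<gamma> * m \<and> \<kappa> * m \<le> average D w"
      if "D \<in> F" for D
    proof -
      obtain x j where x: "x \<in> Q" "D = dcell a l j x" "?P D" "\<And>i. i < j \<Longrightarrow> \<not> ?P (dcell a l i x)"
        using \<open>D \<in> F\<close> unfolding F_def by (elim stopped_cases) blast
      have root: "dcell a l 0 x = Q" using dcell_0[OF l] x(1) by (simp add: Q_def)
      have "j \<noteq> 0"
      proof
        assume "j = 0"
        then have "m \<le> \<gamma> * m" using x root by (simp add: m_def)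
        then show False using \<gamma> m by simp
      qed
      then obtain i where i: "j = Suc i" by (meson not0_implies_Suc)
      obtain b where b: "D = hcube b (l / 2 ^ i / 2)"
        using x(2) i dcell_eq_hcube[OF l, of a j x] by (simp add: mult.commute)
      obtain c where c: "dcell a l i x = hcube c (l / 2 ^ i)"
        using dcell_eq_hcube[OF l, of a i x] by blast
      have "D \<subseteq> dcell a l i x" using dcell_antimono[of i j a l x] x(2) i by simp
      then have "\<delta> / 2 * average (dcell a l i x) w \<le> average D w"
        using average_half_cube[of "l / 2 ^ i" b c] l b c by simp
      moreover have "\<gamma> * m < average (dcell a l i x) w" using x(4)[of i] i by simp
      then have "\<delta> / 2 * (\<gamma> * m) \<le> \<delta> / 2 * average (dcell a l i x) w"
        using \<delta> by (intro mult_left_mono) auto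
      moreover have "\<kappa> * m = \<delta> / 2 * (\<gamma> * m)" using \<kappa>(3) by simp
      ultimately have "\<kappa> * m \<le> average D w" by linarith
      moreover have "D \<subseteq> Q" using dcell_antimono[of 0 j a l x] root x(2) by simp
      ultimately show ?thesis using b x(3) l by (intro exI[of _ b] exI[of _ "l / 2 ^ i / 2"]) simp
    qed
    have Ssets: "S \<in> sets lebesgue" using F by (auto simp: S_def intro!: sets.countable_Union)
    have SQ: "S \<subseteq> Q" using stop by (auto simp: S_def)
    have Sm: "S \<in> lmeasurable" using fmeasurableI2[OF Qm SQ Ssets] .
    have Em: "E \<in> lmeasurable" unfolding E_def by (rule low_set_measurable[OF Qm])
    \<comment> \<open>On at least half of each stopped cube \<open>w < \<delta> w\<^sub>Q\<close>, since otherwise its average would exceed \<open>\<gamma> w\<^sub>Q\<close>.\<close>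
    define H where "H = {x \<in> Q. w x < \<delta> * m}"
    have Hm: "H \<in> lmeasurable" unfolding H_def by (rule low_set_measurable[OF Qm])
    have "emeasure lebesgue S \<le> ennreal 2 * emeasure lebesgue H"
    proof (rule emeasure_le_over_partition[OF F(1,2)])
      fix D assume D: "D \<in> F"
      then obtain b s where bs: "0 < s" "D = hcube b s" "D \<subseteq> Q" "average D w \<le> \<gamma> * m" using stop by blast
      have Dm: "D \<in> lmeasurable" and Dpos: "0 < measure lebesgue D"
        using bs by (simp_all add: lmeasurable_hcube measure_hcube)
      have "\<delta> * m * measure lebesgue {x \<in> D. \<delta> * m \<le> w x} \<le> (LINT x:D|lebesgue. w x)"
        using set_markov_inequality[OF meas nonneg int[OF bs(1), of b] lmeasurable_hcube, of "\<delta> * m"] bs(2) \<delta> m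
        by simp
      also have "\<dots> \<le> \<gamma> * m * measure lebesgue D"
        unfolding mass_eq_average[OF Dpos] using bs(4) Dpos by (intro mult_right_mono) auto
      also have "\<dots> = \<delta> * m * (measure lebesgue D / 2)" by (simp add: \<gamma>_def)
      finally have "measure lebesgue {x \<in> D. \<delta> * m \<le> w x} \<le> measure lebesgue D / 2"
        using \<delta> m by simp
      then have "measure lebesgue D \<le> 2 * measure lebesgue {x \<in> D. w x < \<delta> * m}"
        using split_at_level[OF Dm, of "\<delta> * m"] by simp
      moreover have "{x \<in> D. w x < \<delta> * m} = H \<inter> D" "S \<inter> D = D" using bs(3) D by (auto simp: H_def S_def)
      ultimately have "measure lebesgue (S \<inter> D) \<le> 2 * measure lebesgue (H \<inter> D)" by simp
      moreover have "S \<inter> D \<in> lmeasurable" "H \<inter> D \<in> lmeasurable" using Sm Hm Dm by auto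
      ultimately show "emeasure lebesgue (S \<inter> D) \<le> ennreal 2 * emeasure lebesgue (H \<inter> D)"
        by (simp add: emeasure_eq_measure2 del: ennreal_numeral flip: ennreal_mult)
    qed (use F Ssets Hm in \<open>auto simp: S_def\<close>)
    then have "measure lebesgue S \<le> 2 * measure lebesgue H"
      using Sm Hm by (simp add: emeasure_eq_measure2 del: ennreal_numeral flip: ennreal_mult)
    also have "measure lebesgue H \<le> measure lebesgue Q / (4 * 2 ^ CARD('n))"
      using thin[OF l, of a] by (simp add: H_def Q_def m_def)
    also have "\<dots> \<le> measure lebesgue Q / 4" by (intro divide_left_mono) auto
    finally have Ssmall: "measure lebesgue S \<le> measure lebesgue Q / 2" by simp
    \<comment> \<open>Every dyadic cell around a point outside \<open>S\<close> has average above \<open>\<gamma> w\<^sub>Q\<close>, so points of \<open>E\<close>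
        are exceptional in it and fill at most a quarter of it.\<close>
    have "measure lebesgue (E - S) = 0"
    proof (rule null_if_thin_in_cells[OF l, of _ a])
      show "E - S \<in> lmeasurable" using Em Ssets by (rule fmeasurable_Diff)
      fix x j assume x: "x \<in> E - S"
      have xQ: "x \<in> Q" using x by (simp add: E_def)
      define D where "D = dcell a l j x"
      define s where "s = l / 2 ^ j"
      obtain b where b: "D = hcube b s" unfolding D_def s_def using dcell_eq_hcube[OF l, of a j x] by blast
      have bs: "0 < s" "D = hcube b s" using l b by (simp_all add: s_def)
      have Dm: "D \<in> lmeasurable" using bs by (simp add: lmeasurable_hcube)
      have "\<not> average D w \<le> \<gamma> * m"
      proof
        assume "?P D"
        then have "x \<in> \<Union>F" unfolding F_def D_def by (rule stopped_cover[OF xQ])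
        then show False using x by (simp add: S_def)
      qed
      then have big: "\<gamma> * m < average D w" by simp
      have "\<kappa> ^ Suc k * m \<le> \<kappa> * m" using \<kappa> m power_le_one[of \<kappa> k] by (simp add: mult_le_one mult_left_le)
      also have "\<dots> \<le> \<delta> * (\<gamma> * m)" using \<kappa>(4) m by simp
      also have "\<dots> \<le> \<delta> * average D w" using big \<delta> by simp
      finally have lev: "\<kappa> ^ Suc k * m \<le> \<delta> * average D w" .
      have "measure lebesgue ((E - S) \<inter> D) \<le> measure lebesgue {x \<in> D. w x < \<delta> * average D w}"
        by (rule measure_mono_fmeasurable)
           (use Em Ssets Dm lev low_set_measurable in \<open>auto simp: E_def\<close>)
      also have "\<dots> \<le> measure lebesgue D / (4 * 2 ^ CARD('n))" using thin[OF bs(1), of b] bs(2) by simp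
      also have "\<dots> \<le> measure lebesgue D / 4" by (intro divide_left_mono) auto
      finally show "measure lebesgue ((E - S) \<inter> dcell a l j x) \<le> measure lebesgue (dcell a l j x) / 4"
        by (simp add: D_def)
    qed
    moreover have "measure lebesgue E \<le> measure lebesgue (E \<inter> S) + measure lebesgue (E - S)"
      using measure_Un_le[of "E \<inter> S" lebesgue "E - S"] Em Ssets by (simp add: Int_Diff_Un fmeasurableD)
    moreover have "measure lebesgue (E \<inter> S) \<le> 1 / 2 ^ k * measure lebesgue S"
    proof -
      have "emeasure lebesgue (E \<inter> S) \<le> ennreal (1 / 2 ^ k) * emeasure lebesgue S"
      proof (rule emeasure_le_over_partition[OF F(1,2)])
        fix D assume D: "D \<in> F"
        then obtain b s where bs: "0 < s" "D = hcube b s" "D \<subseteq> Q" "\<kappa> * m \<le> average D w" using stop by blast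
        have Dm: "D \<in> lmeasurable" using bs by (simp add: lmeasurable_hcube)
        have lev: "\<kappa> ^ Suc k * m \<le> \<kappa> ^ k * average D w"
        proof -
          have "\<kappa> ^ Suc k * m = \<kappa> ^ k * (\<kappa> * m)" by (simp only: power_Suc mult_ac)
          also have "\<dots> \<le> \<kappa> ^ k * average D w" using bs(4) \<kappa>(1) by (intro mult_left_mono) auto
          finally show ?thesis .
        qed
        have "measure lebesgue (E \<inter> S \<inter> D) \<le> measure lebesgue {x \<in> D. w x < \<kappa> ^ k * average D w}"
          by (rule measure_mono_fmeasurable)
             (use Em Ssets Dm lev low_set_measurable in \<open>auto simp: E_def\<close>)
        also have "\<dots> \<le> measure lebesgue D / 2 ^ k" using Suc.IH[OF bs(1), of b] bs(2) by (simp add: \<kappa>_def)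
        finally have "measure lebesgue (E \<inter> S \<inter> D) \<le> 1 / 2 ^ k * measure lebesgue D" by simp
        moreover have "S \<inter> D = D" using D by (auto simp: S_def)
        ultimately have "measure lebesgue (E \<inter> S \<inter> D) \<le> 1 / 2 ^ k * measure lebesgue (S \<inter> D)" by simp
        moreover have "E \<inter> S \<inter> D \<in> lmeasurable" "S \<inter> D \<in> lmeasurable" using Sm Em Dm by auto
        ultimately show "emeasure lebesgue (E \<inter> S \<inter> D) \<le> ennreal (1 / 2 ^ k) * emeasure lebesgue (S \<inter> D)"
          by (simp add: emeasure_eq_measure2 flip: ennreal_mult)
      qed (use F Ssets Em in \<open>auto simp: S_def\<close>)
      moreover have "E \<inter> S \<in> lmeasurable" using Sm Em by auto
      ultimately show ?thesis
        using Sm by (simp add: emeasure_eq_measure2 flip: ennreal_mult)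
    qed
    moreover have "1 / 2 ^ k * measure lebesgue S \<le> 1 / 2 ^ k * (measure lebesgue Q / 2)"
      using Ssmall by (intro mult_left_mono) auto
    ultimately have "measure lebesgue E \<le> measure lebesgue Q / 2 ^ Suc k" by simp
    then show ?thesis by (simp add: E_def Q_def m_def \<kappa>_def)
  qed
qed

text \<open>Layer cake: \<open>ln (w\<^sub>Q / w)\<close> is at most \<open>ln (1/\<kappa>)\<close> times the number of \<open>k\<close> with \<open>w < \<kappa>\<^sup>k w\<^sub>Q\<close>, where \<open>\<kappa> = \<delta>\<^sup>2/4\<close>, and those
  sets have measures summing to at most \<open>2 |Q|\<close>. The value \<open>\<infinity>\<close> at zeros of \<open>w\<close> makes the bound
  include the statement that \<open>w\<close> vanishes only on a null set. (The conversion \<open>ennreal\<close> cuts off the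
  negative part of the logarithm.)\<close>

lemma nn_integral_log_deficit:
  assumes "0 < l" and pos: "0 < average (hcube a l) w"
  shows "(\<integral>\<^sup>+x\<in>hcube a l. (if w x = 0 then \<infinity> else ennreal (ln (average (hcube a l) w / w x))) \<partial>lebesgue)
       \<le> ennreal (2 * ln (4 / \<delta>\<^sup>2) * measure lebesgue (hcube a l))"
proof -
  define Q where "Q = hcube a l"
  define m where "m = average Q w"
  define \<kappa> where "\<kappa> = \<delta>\<^sup>2 / 4"
  define L where "L = ln (1 / \<kappa>)"
  have \<kappa>: "0 < \<kappa>" "\<kappa> < 1"
    using \<delta> power_le_one[of \<delta> 2] by (auto simp: \<kappa>_def)
  have L: "0 < L" using \<kappa> by (simp add: L_def)
  have m: "0 < m" using pos by (simp add: m_def Q_def)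
  have Qm: "Q \<in> lmeasurable" by (simp add: Q_def lmeasurable_hcube)
  define E where "E k = {x \<in> Q. w x < \<kappa> ^ k * m}" for k
  have Em: "E k \<in> lmeasurable" for k unfolding E_def by (rule low_set_measurable[OF Qm])
  have Ele: "emeasure lebesgue (E k) \<le> ennreal (measure lebesgue Q * (1 / 2) ^ k)" for k
  proof -
    have "measure lebesgue (E k) \<le> measure lebesgue Q * (1 / 2) ^ k"
      using low_set_decay[OF assms(1), of a k]
      unfolding E_def Q_def m_def \<kappa>_def power_one_over by simp
    then show ?thesis unfolding emeasure_eq_measure2[OF Em[of k]] by (rule ennreal_leI)
  qed
  have pt: "(if w x = 0 then \<infinity> else ennreal (ln (m / w x))) * indicator Q x
      \<le> (\<Sum>k. ennreal L * indicator (E k) x)" for x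
  proof (cases "x \<in> Q")
    case True
    have lower: "ennreal (L * real K) \<le> (\<Sum>k. ennreal L * indicator (E k) x)"
      if "\<And>k. k < K \<Longrightarrow> w x < \<kappa> ^ k * m" for K
    proof -
      have "ennreal (L * real K) = (\<Sum>k<K. ennreal L)"
        using L by (subst sum_ennreal) (auto simp: mult.commute)
      also have "\<dots> = (\<Sum>k<K. ennreal L * indicator (E k) x)"
        by (rule sum.cong) (use that True in \<open>auto simp: E_def\<close>)
      also have "\<dots> \<le> (\<Sum>k. ennreal L * indicator (E k) x)" by (rule sum_le_suminf) auto
      finally show ?thesis .
    qed
    show ?thesis
    proof (cases "w x = 0")
      case True
      have "(\<Sum>k. ennreal L * indicator (E k) x) = \<infinity>"
      proof (rule ccontr)
        assume "(\<Sum>k. ennreal L * indicator (E k) x) \<noteq> \<infinity>"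
        then obtain r where r: "0 \<le> r" "(\<Sum>k. ennreal L * indicator (E k) x) = ennreal r"
          by (metis ennreal_cases infinity_ennreal_def)
        obtain K :: nat where K: "r < real K * L" using reals_Archimedean3[OF L] by blast
        have "ennreal (L * real K) \<le> ennreal r" using lower[of K] True \<kappa> m r by simp
        then show False using K r L by (simp add: ennreal_le_iff mult.commute)
      qed
      then show ?thesis using True by simp
    next
      case False
      then have wp: "0 < w x" using nonneg[of x] by simp
      have ex: "\<exists>k. \<kappa> ^ k * m \<le> w x"
      proof -
        obtain k where "\<kappa> ^ k < w x / m" using real_arch_pow_inv[of "w x / m" \<kappa>] \<kappa> wp m by auto
        then show ?thesis using m by (auto simp: field_simps intro!: exI[of _ k])
      qed
      define K where "K = (LEAST k. \<kappa> ^ k * m \<le> w x)"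
      have K: "\<kappa> ^ K * m \<le> w x" unfolding K_def by (rule LeastI_ex[OF ex])
      have "w x < \<kappa> ^ k * m" if "k < K" for k using not_less_Least that unfolding K_def by fastforce
      then have "ennreal (L * real K) \<le> (\<Sum>k. ennreal L * indicator (E k) x)" by (rule lower)
      moreover have "ln (m / w x) \<le> L * real K"
      proof -
        have "m / w x \<le> (1 / \<kappa>) ^ K" using K wp \<kappa> by (simp add: field_simps)
        then have "ln (m / w x) \<le> ln ((1 / \<kappa>) ^ K)" using m wp \<kappa> by (intro ln_mono) auto
        also have "\<dots> = L * real K" using \<kappa> by (simp add: ln_realpow L_def)
        finally show ?thesis .
      qed
      ultimately show ?thesis using False True by (simp add: order_trans[OF ennreal_leI])
    qed
  qed simp
  have "(\<integral>\<^sup>+x. (if w x = 0 then \<infinity> else ennreal (ln (m / w x))) * indicator Q x \<partial>lebesgue)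
     \<le> (\<integral>\<^sup>+x. (\<Sum>k. ennreal L * indicator (E k) x) \<partial>lebesgue)"
    by (rule nn_integral_mono) (rule pt)
  also have "\<dots> = (\<Sum>k. ennreal L * emeasure lebesgue (E k))"
    using Em by (subst nn_integral_suminf) (auto simp: nn_integral_cmult fmeasurableD)
  also have "\<dots> \<le> (\<Sum>k. ennreal (L * measure lebesgue Q * (1 / 2) ^ k))"
  proof (rule suminf_le)
    fix k
    show "ennreal L * emeasure lebesgue (E k) \<le> ennreal (L * measure lebesgue Q * (1 / 2) ^ k)"
      using mult_left_mono[OF Ele[of k], of "ennreal L"] L by (simp add: mult.assoc flip: ennreal_mult)
  qed auto
  also have "\<dots> = ennreal (\<Sum>k. L * measure lebesgue Q * (1 / 2) ^ k)"
    using L by (intro suminf_ennreal2 summable_mult summable_geometric) auto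
  also have "(\<Sum>k. L * measure lebesgue Q * (1 / 2 :: real) ^ k) = L * measure lebesgue Q * 2"
    by (subst suminf_mult) (auto simp: suminf_geometric intro!: summable_geometric)
  finally show ?thesis unfolding m_def Q_def L_def \<kappa>_def by (simp add: mult_ac)
qed

end

section \<open>Hermitian matrices: determinants, traces and forms\<close>

lemma mv_scaleR: "(A :: complex^'d^'e) *v (c *\<^sub>R x) = c *\<^sub>R (A *v x)"
  by (simp add: matrix_vector_mult_def vec_eq_iff scaleR_sum_right)

lemma scaleR_mv: "(c *\<^sub>R (A :: complex^'d^'e)) *v x = c *\<^sub>R (A *v x)"
  by (simp add: matrix_vector_mult_def vec_eq_iff scaleR_sum_right)

definition adj :: "complex^'d^'e \<Rightarrow> complex^'e^'d" where
  "adj A = (\<chi> i j. cnj (A $ j $ i))"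

lemma inner_adj: "(A *v x) \<bullet> y = x \<bullet> (adj A *v y)"
proof -
  have i: "a \<bullet> b = Re (cnj a * b)" for a b :: complex
    by (simp add: inner_complex_def)
  have "(A *v x) \<bullet> y = Re (\<Sum>i\<in>UNIV. \<Sum>j\<in>UNIV. cnj (A $ i $ j * x $ j) * y $ i)"
    by (simp only: inner_vec_def matrix_vector_mult_def vec_lambda_beta i cnj_sum sum_distrib_right Re_sum)
  also have "(\<Sum>i\<in>UNIV. \<Sum>j\<in>UNIV. cnj (A $ i $ j * x $ j) * y $ i)
      = (\<Sum>j\<in>UNIV. \<Sum>i\<in>UNIV. cnj (A $ i $ j * x $ j) * y $ i)"
    by (rule sum.swap)
  also have "\<dots> = (\<Sum>j\<in>UNIV. \<Sum>i\<in>UNIV. cnj (x $ j) * (cnj (A $ i $ j) * y $ i))"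
    by (simp add: mult_ac)
  also have "Re \<dots> = x \<bullet> (adj A *v y)"
    by (simp only: inner_vec_def matrix_vector_mult_def vec_lambda_beta i sum_distrib_left Re_sum adj_def)
  finally show ?thesis .
qed

lemma adj_mult: "adj (A ** B) = adj B ** adj A"
  by (simp add: adj_def matrix_matrix_mult_def vec_eq_iff mult.commute)

lemma adj_adj [simp]: "adj (adj A) = A"
  by (simp add: adj_def vec_eq_iff)

lemma hermitian_iff_adj: "hermitian A \<longleftrightarrow> adj A = A"
  unfolding hermitian_def adj_def vec_eq_iff vec_lambda_beta by metis

lemma det_adj: "det (adj A) = cnj (det A)"
proof -
  have "det (adj A) = det (transpose (adj A))" by (simp only: det_transpose)
  also have "\<dots> = cnj (det A)"
    by (simp only: det_def transpose_def adj_def cnj_sum cnj_prod complex_cnj_mult vec_lambda_beta complex_cnj_of_int)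
  finally show ?thesis .
qed

lemma pos_semidef_Cauchy_Schwarz:
  assumes "pos_semidef W"
  shows "(x \<bullet> (W *v y))\<^sup>2 \<le> (x \<bullet> (W *v x)) * (y \<bullet> (W *v y))"
proof -
  define a where "a = x \<bullet> (W *v x)"
  define b where "b = x \<bullet> (W *v y)"
  define c where "c = y \<bullet> (W *v y)"
  have sym: "y \<bullet> (W *v x) = b"
    using inner_adj[of W x y] assms by (simp add: pos_semidef_def hermitian_iff_adj b_def inner_commute)
  have q: "0 \<le> s\<^sup>2 * a + 2 * s * t * b + t\<^sup>2 * c" for s t
  proof -
    have "0 \<le> (s *\<^sub>R x + t *\<^sub>R y) \<bullet> (W *v (s *\<^sub>R x + t *\<^sub>R y))"
      using assms unfolding pos_semidef_def by blast
    also have "\<dots> = s\<^sup>2 * a + 2 * s * t * b + t\<^sup>2 * c"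
      by (simp add: matrix_vector_right_distrib mv_scaleR inner_add_left inner_add_right sym power2_eq_square
          flip: a_def b_def c_def) (simp add: algebra_simps)
    finally show ?thesis .
  qed
  have ac: "0 \<le> a" "0 \<le> c" using assms by (auto simp: a_def c_def pos_semidef_def)
  have "b\<^sup>2 \<le> a * c"
  proof (cases "c = 0")
    case True
    have "b = 0"
    proof (rule ccontr)
      assume "b \<noteq> 0"
      define t where "t = - (a + 1) / (2 * b)"
      have "2 * t * b = - (a + 1)" using \<open>b \<noteq> 0\<close> by (simp add: t_def)
      then show False using q[of 1 t] True by simp
    qed
    then show ?thesis using True by simp
  next
    case False
    have "0 \<le> c * (a * c - b\<^sup>2)"
      using q[of c "- b"] by (simp add: power2_eq_square algebra_simps)
    then show ?thesis using False ac by (simp add: zero_le_mult_iff)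
  qed
  then show ?thesis by (simp add: a_def b_def c_def)
qed

definition rtrace :: "complex^'d^'d \<Rightarrow> real" where
  "rtrace W = (\<Sum>k\<in>UNIV. Re (W $ k $ k))"

lemma mv_axis: "(W *v axis j c) $ i = W $ i $ j * c"
  by (simp add: matrix_vector_mult_def axis_def if_distrib sum.delta cong: if_cong)

lemma inner_axis_mv: "axis i b \<bullet> (W *v axis j c) = Re (cnj b * W $ i $ j * c)"
  by (simp add: inner_axis' mv_axis inner_complex_def algebra_simps)

text \<open>Cauchy--Schwarz for the form of \<open>W\<close> on the coordinate vectors. Real and imaginary part are
  estimated separately, using \<open>1\<close> and \<open>\<i>\<close> times a coordinate vector, whence the factor \<open>2\<close>.\<close>

lemma pos_semidef_entry:
  assumes "pos_semidef W"
  shows "cmod (W $ i $ j) \<le> 2 * rtrace W"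
proof -
  have diag: "0 \<le> Re (W $ k $ k)" for k
  proof -
    have "0 \<le> axis k 1 \<bullet> (W *v axis k 1)" using assms unfolding pos_semidef_def by blast
    then show ?thesis by (simp add: inner_axis_mv)
  qed
  have le: "Re (W $ k $ k) \<le> rtrace W" for k
    unfolding rtrace_def by (rule member_le_sum) (use diag in auto)
  have T: "0 \<le> rtrace W" using diag[of i] le[of i] by simp
  have cs: "\<bar>axis i b \<bullet> (W *v axis j 1)\<bar> \<le> rtrace W" if "b = 1 \<or> b = \<i>" for b
  proof -
    have "(axis i b \<bullet> (W *v axis j 1))\<^sup>2 \<le> Re (W $ i $ i) * Re (W $ j $ j)"
      using pos_semidef_Cauchy_Schwarz[OF assms, of "axis i b" "axis j 1"] that
      by (auto simp: inner_axis_mv)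
    also have "\<dots> \<le> rtrace W * rtrace W"
      by (intro mult_mono) (use diag le T in auto)
    finally have "(axis i b \<bullet> (W *v axis j 1))\<^sup>2 \<le> (rtrace W)\<^sup>2" by (simp only: power2_eq_square)
    then show ?thesis using T abs_le_square_iff[of "axis i b \<bullet> (W *v axis j 1)" "rtrace W"] by simp
  qed
  have "\<bar>Re (W $ i $ j)\<bar> \<le> rtrace W" using cs[of 1] by (simp add: inner_axis_mv)
  moreover have "\<bar>Im (W $ i $ j)\<bar> \<le> rtrace W" using cs[of \<i>] by (simp add: inner_axis_mv)
  ultimately show ?thesis using cmod_le[of "W $ i $ j"] by simp
qed

lemma cmod_det_le:
  fixes A :: "complex^'d^'d"
  assumes "\<And>i j. cmod (A $ i $ j) \<le> b j"
  shows "cmod (det A) \<le> fact CARD('d) * (\<Prod>j\<in>UNIV. b j)"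
proof -
  have b: "0 \<le> b j" for j by (rule order_trans[OF norm_ge_zero assms[of undefined j]])
  have "cmod (det A) = cmod (det (transpose A))" by simp
  also have "\<dots> \<le> (\<Sum>p\<in>{p. p permutes (UNIV :: 'd set)}. cmod (of_int (sign p) * (\<Prod>i\<in>UNIV. transpose A $ i $ p i)))"
    unfolding det_def by (rule norm_sum)
  also have "\<dots> \<le> (\<Sum>p\<in>{p. p permutes (UNIV :: 'd set)}. \<Prod>j\<in>UNIV. b j)"
  proof (rule sum_mono)
    fix p :: "'d \<Rightarrow> 'd"
    have "cmod (of_int (sign p) * (\<Prod>i\<in>UNIV. transpose A $ i $ p i)) = (\<Prod>i\<in>UNIV. cmod (A $ p i $ i))"
      by (simp add: norm_mult prod_norm transpose_def sign_def)
    also have "\<dots> \<le> (\<Prod>j\<in>UNIV. b j)" by (rule prod_mono) (use assms in auto)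
    finally show "cmod (of_int (sign p) * (\<Prod>i\<in>UNIV. transpose A $ i $ p i)) \<le> (\<Prod>j\<in>UNIV. b j)" .
  qed
  also have "\<dots> = fact CARD('d) * (\<Prod>j\<in>UNIV. b j)"
    by (simp add: card_permutations)
  finally show ?thesis .
qed

lemma pos_semidef_det_nz_imp_pos_def:
  assumes "pos_semidef W" "det W \<noteq> 0"
  shows "pos_def W"
  unfolding pos_def_def
proof (intro conjI allI impI)
  show "hermitian W" using assms by (simp add: pos_semidef_def)
  fix v :: "complex^'a" assume v: "v \<noteq> 0"
  have "v \<bullet> (W *v v) \<noteq> 0"
  proof
    assume z: "v \<bullet> (W *v v) = 0"
    have "((W *v v) \<bullet> (W *v v))\<^sup>2 \<le> 0"
      using pos_semidef_Cauchy_Schwarz[OF assms(1), of "W *v v" v] z by simp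
    then have "W *v v = 0" by simp
    moreover have "inj ((*v) W)"
      using assms(2) invertible_eq_bij[of W] invertible_det_nz[of W] by (simp add: bij_is_inj)
    ultimately show False using v injD[of "(*v) W" v 0] by simp
  qed
  moreover have "0 \<le> v \<bullet> (W *v v)" using assms by (simp add: pos_semidef_def)
  ultimately show "0 < v \<bullet> (W *v v)" by simp
qed

lemma pos_def_det_nz:
  assumes "pos_def W" shows "det W \<noteq> 0"
proof -
  have "inj ((*v) W)"
  proof (rule injI)
    fix x y assume "W *v x = W *v y"
    then have "(x - y) \<bullet> (W *v (x - y)) = 0" by (simp add: matrix_vector_mult_diff_distrib)
    then have "x - y = 0" using assms unfolding pos_def_def by (metis less_irrefl)
    then show "x = y" by simp
  qed
  then show ?thesis
    using matrix_left_invertible_injective[of W] invertible_left_inverse invertible_det_nz by blast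
qed

lemma continuous_on_det:
  fixes f :: "'t::topological_space \<Rightarrow> complex^'d^'d"
  assumes "continuous_on S f" shows "continuous_on S (\<lambda>t. det (f t))"
proof -
  have "continuous_on S (\<lambda>t. f t $ i $ j)" for i j
    by (rule continuous_on_component[OF continuous_on_component[OF assms]])
  then show ?thesis unfolding det_def
    by (intro continuous_on_sum continuous_on_mult[OF continuous_on_const] continuous_on_prod)
qed

lemma continuous_on_rdet: "continuous_on S f \<Longrightarrow> continuous_on S (\<lambda>t. rdet (f t))"
  unfolding rdet_def by (intro continuous_on_Re continuous_on_det)

lemma pos_def_imp_psd: "pos_def W \<Longrightarrow> pos_semidef W"
  unfolding pos_def_def pos_semidef_def
proof (elim conjE, intro conjI allI)
  fix v assume "\<forall>v. v \<noteq> 0 \<longrightarrow> 0 < v \<bullet> (W *v v)"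
  then show "0 \<le> v \<bullet> (W *v v)" by (cases "v = 0") (simp_all add: less_imp_le)
qed

lemma inner_self_mat1: "v \<bullet> (mat 1 *v v) = (norm v)\<^sup>2" for v :: "complex^'d"
  by (simp add: power2_norm_eq_inner)

text \<open>On the segment from the identity to \<open>W\<close> all matrices are positive definite, so the real
  number \<open>rdet\<close> does not vanish there and keeps the sign it has at the identity.\<close>

lemma pos_def_rdet_pos:
  fixes W :: "complex^'d^'d"
  assumes "pos_def W" shows "0 < rdet W"
proof -
  define p where "p t = (1 - t) *\<^sub>R (mat 1 :: complex^'d^'d) + t *\<^sub>R W" for t :: real
  have pd: "pos_def (p t)" if "0 \<le> t" "t \<le> 1" for t
    unfolding pos_def_def
  proof (intro conjI allI impI)
    show "hermitian (p t)"
      unfolding hermitian_def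
    proof (intro allI)
      fix i j
      have "W $ i $ j = cnj (W $ j $ i)" using assms unfolding pos_def_def hermitian_def by blast
      then show "p t $ i $ j = cnj (p t $ j $ i)" by (simp add: p_def mat_def)
    qed
    fix v :: "complex^'d" assume v: "v \<noteq> 0"
    have "v \<bullet> (p t *v v) = (1 - t) * (norm v)\<^sup>2 + t * (v \<bullet> (W *v v))"
      by (simp add: p_def matrix_vector_mult_add_rdistrib scaleR_mv inner_add_right inner_self_mat1
          power2_norm_eq_inner)
    also have "\<dots> > 0"
      using that v assms by (cases "t = 0") (auto simp: pos_def_def intro!: add_nonneg_pos)
    finally show "0 < v \<bullet> (p t *v v)" .
  qed
  have nz: "rdet (p t) \<noteq> 0" if "0 \<le> t" "t \<le> 1" for t
    using pos_def_det_nz[OF pd[OF that]] hermitian_det[of "p t"] pd[OF that] by (auto simp: pos_def_def)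
  have cont: "continuous_on {0..1} (\<lambda>t. rdet (p t))"
    unfolding p_def by (intro continuous_on_rdet continuous_intros)
  have 0: "rdet (p 0) = 1" by (simp add: p_def rdet_def)
  have 1: "p 1 = W" by (simp add: p_def)
  show ?thesis
  proof (rule ccontr)
    assume "\<not> 0 < rdet W"
    then obtain t where "0 \<le> t" "t \<le> 1" "rdet (p t) = 0"
      using IVT2'[of "\<lambda>t. rdet (p t)" 1 0 0] cont 0 1 by auto
    then show False using nz by blast
  qed
qed

lemma pos_semidef_rdet_nonneg:
  assumes "pos_semidef W" shows "0 \<le> rdet W"
proof (cases "det W = 0")
  case True then show ?thesis by (simp add: rdet_def)
next
  case False
  then show ?thesis using pos_def_rdet_pos pos_semidef_det_nz_imp_pos_def assms less_imp_le by blast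
qed

lemma pos_semidef_rdet_cmod: "pos_semidef W \<Longrightarrow> rdet W = cmod (det W)"
  using hermitian_det[of W] pos_semidef_rdet_nonneg[of W] by (simp add: pos_semidef_def)

lemma pos_semidef_rdet_le:
  fixes W :: "complex^'d^'d"
  assumes "pos_semidef W"
  shows "rdet W \<le> fact CARD('d) * (2 * rtrace W) ^ CARD('d)"
  using cmod_det_le[of W "\<lambda>_. 2 * rtrace W"] pos_semidef_entry[OF assms] pos_semidef_rdet_cmod[OF assms]
  by simp

text \<open>The inverse of \<open>W\<close> has norm at most \<open>1/\<delta>\<close>, so its entries and hence its determinant are
  bounded.\<close>

lemma rdet_ge_of_coercive:
  fixes W :: "complex^'d^'d"
  assumes W: "pos_semidef W" and \<delta>: "0 < \<delta>" and coer: "\<And>v. \<delta> * (norm v)\<^sup>2 \<le> v \<bullet> (W *v v)"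
  shows "\<delta> ^ CARD('d) \<le> fact CARD('d) * rdet W"
proof -
  have "pos_def W" unfolding pos_def_def
  proof (intro conjI allI impI)
    fix v :: "complex^'d" assume "v \<noteq> 0"
    then have "0 < \<delta> * (norm v)\<^sup>2" using \<delta> by simp
    then show "0 < v \<bullet> (W *v v)" using coer[of v] by linarith
  qed (use W in \<open>simp add: pos_semidef_def\<close>)
  then obtain X where X: "W ** X = mat 1"
    using pos_def_det_nz invertible_det_nz invertible_right_inverse by metis
  have entry: "cmod (X $ i $ j) \<le> 1 / \<delta>" for i j
  proof -
    define x where "x = X *v axis j 1"
    have Wx: "W *v x = axis j 1" unfolding x_def by (simp add: matrix_vector_mul_assoc X)
    have "\<delta> * (norm x)\<^sup>2 \<le> x \<bullet> axis j 1" using coer[of x] Wx by simp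
    also have "\<dots> \<le> norm x * norm (axis j (1 :: complex) :: complex^'d)" by (rule norm_cauchy_schwarz)
    also have "norm (axis j (1 :: complex) :: complex^'d) = 1"
      by (simp add: norm_eq_sqrt_inner inner_axis_axis)
    finally have le: "norm x * (\<delta> * norm x) \<le> norm x * 1" by (simp add: power2_eq_square mult_ac)
    have "norm x \<le> 1 / \<delta>"
    proof (cases "x = 0")
      case False
      then have "\<delta> * norm x \<le> 1" using mult_left_le_imp_le[OF le] by simp
      then show ?thesis using \<delta> by (simp add: pos_le_divide_eq mult.commute)
    qed (use \<delta> in simp)
    moreover have "cmod (X $ i $ j) \<le> norm x"
      using Finite_Cartesian_Product.norm_nth_le[of x i] by (simp add: x_def mv_axis)
    ultimately show ?thesis by simp
  qed
  have "1 = cmod (det W * det X)" by (simp add: X flip: det_mul)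
  also have "\<dots> = rdet W * cmod (det X)" by (simp add: norm_mult pos_semidef_rdet_cmod[OF W])
  also have "\<dots> \<le> rdet W * (fact CARD('d) * (1 / \<delta>) ^ CARD('d))"
    using cmod_det_le[of X "\<lambda>_. 1 / \<delta>"] entry pos_semidef_rdet_nonneg[OF W] by (intro mult_left_mono) auto
  finally show ?thesis using \<delta> by (simp add: field_simps)
qed

text \<open>A quantitative form of ``determinant over the other eigenvalues bounds the least eigenvalue''.
  With \<open>x = W\<^sup>-\<^sup>1 v\<close>, Cauchy--Schwarz for \<open>W\<close> gives \<open>|v|\<^sup>4 \<le> (v \<bullet> W v) (x \<bullet> v)\<close>, and Cramer's rule bounds
  \<open>|x|\<close> by \<open>t\<^sup>d\<^sup>-\<^sup>1 |v| / det W\<close> up to a constant.\<close>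

lemma form_ge_of_rdet:
  fixes W :: "complex^'d^'d" and t :: real
  assumes W: "pos_semidef W" and D: "0 < rdet W" and t: "rtrace W \<le> t"
  shows "rdet W * (norm v)\<^sup>2 \<le> real CARD('d) * fact CARD('d) * (2 * t) ^ (CARD('d) - 1) * (v \<bullet> (W *v v))"
proof (cases "v = 0")
  case False
  define N where "N = fact CARD('d) * (2 * t) ^ (CARD('d) - 1)"
  have Dc: "rdet W = cmod (det W)" using pos_semidef_rdet_cmod[OF W] .
  then have "det W \<noteq> 0" using D by auto
  then obtain X where X: "W ** X = mat 1"
    using invertible_det_nz invertible_right_inverse by metis
  define x where "x = X *v v"
  have Wx: "W *v x = v" unfolding x_def by (simp add: matrix_vector_mul_assoc X)
  have entry: "cmod (W $ i $ j) \<le> 2 * t" for i j using pos_semidef_entry[OF W, of i j] t by simp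
  have comp: "rdet W * cmod (x $ k) \<le> N * norm v" for k
  proof -
    let ?A = "(\<chi> i j. if j = k then (W *v x) $ i else W $ i $ j) :: complex^'d^'d"
    have "rdet W * cmod (x $ k) = cmod (det ?A)"
      unfolding cramer_lemma by (simp add: norm_mult Dc)
    also have "\<dots> \<le> fact CARD('d) * (\<Prod>j\<in>UNIV. if j = k then norm v else 2 * t)"
      by (rule cmod_det_le) (use entry Wx Finite_Cartesian_Product.norm_nth_le[of v] in auto)
    also have "(\<Prod>j\<in>UNIV. if j = k then norm v else 2 * t) = norm v * (2 * t) ^ (CARD('d) - 1)"
      by (subst prod.remove[of _ k]) (auto simp: card_Diff_singleton)
    finally show ?thesis by (simp add: N_def mult_ac)
  qed
  have "norm x \<le> (\<Sum>k\<in>UNIV. cmod (x $ k))"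
    unfolding norm_vec_def by (rule L2_set_le_sum) simp
  then have "rdet W * norm x \<le> rdet W * (\<Sum>k\<in>UNIV. cmod (x $ k))"
    using D by simp
  also have "\<dots> \<le> (\<Sum>k\<in>(UNIV :: 'd set). N * norm v)"
    unfolding sum_distrib_left by (rule sum_mono) (rule comp)
  finally have nx: "rdet W * norm x \<le> CARD('d) * N * norm v" by simp
  have vWv: "0 \<le> v \<bullet> (W *v v)" using W by (simp add: pos_semidef_def)
  have "rdet W * ((norm v)\<^sup>2)\<^sup>2 = rdet W * (v \<bullet> (W *v x))\<^sup>2" by (simp add: Wx power2_norm_eq_inner)
  also have "\<dots> \<le> rdet W * ((v \<bullet> (W *v v)) * (x \<bullet> (W *v x)))"
    using D by (intro mult_left_mono pos_semidef_Cauchy_Schwarz[OF W]) auto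
  also have "\<dots> \<le> rdet W * ((v \<bullet> (W *v v)) * (norm x * norm v))"
    using D vWv norm_cauchy_schwarz[of x v] by (intro mult_left_mono) (auto simp: Wx)
  also have "\<dots> = (v \<bullet> (W *v v)) * norm v * (rdet W * norm x)" by simp
  also have "\<dots> \<le> (v \<bullet> (W *v v)) * norm v * (CARD('d) * N * norm v)"
    using nx vWv by (intro mult_left_mono) auto
  also have "rdet W * ((norm v)\<^sup>2)\<^sup>2 = (rdet W * (norm v)\<^sup>2) * (norm v)\<^sup>2"
    by (simp only: power2_eq_square mult_ac)
  also have "(v \<bullet> (W *v v)) * norm v * (CARD('d) * N * norm v) = (CARD('d) * N * (v \<bullet> (W *v v))) * (norm v)\<^sup>2"
    by (simp only: power2_eq_square mult_ac)
  finally have "rdet W * (norm v)\<^sup>2 \<le> CARD('d) * N * (v \<bullet> (W *v v))"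
    by (rule mult_right_le_imp_le) (use False in simp)
  then show ?thesis by (simp only: N_def mult_ac)
qed simp

lemma form_le_entry_bound:
  fixes W :: "complex^'d^'d"
  assumes "\<And>i j. cmod (W $ i $ j) \<le> b"
  shows "v \<bullet> (W *v v) \<le> b * CARD('d)\<^sup>2 * (norm v)\<^sup>2"
proof -
  have "norm (W *v v) \<le> (\<Sum>i\<in>UNIV. cmod ((W *v v) $ i))"
    unfolding norm_vec_def by (rule L2_set_le_sum) simp
  also have "\<dots> \<le> (\<Sum>i\<in>(UNIV :: 'd set). \<Sum>j\<in>(UNIV :: 'd set). b * norm v)"
  proof (rule sum_mono)
    fix i
    have "cmod ((W *v v) $ i) \<le> (\<Sum>j\<in>UNIV. cmod (W $ i $ j * v $ j))"
      by (simp add: matrix_vector_mult_def norm_sum)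
    also have "\<dots> \<le> (\<Sum>j\<in>(UNIV :: 'd set). b * norm v)"
      unfolding norm_mult
      by (intro sum_mono mult_mono assms Finite_Cartesian_Product.norm_nth_le order_trans[OF norm_ge_zero assms]) auto
    finally show "cmod ((W *v v) $ i) \<le> (\<Sum>j\<in>(UNIV :: 'd set). b * norm v)" .
  qed
  also have "\<dots> = b * CARD('d)\<^sup>2 * norm v" by (simp add: power2_eq_square)
  finally have "norm v * norm (W *v v) \<le> norm v * (b * CARD('d)\<^sup>2 * norm v)" by (rule mult_left_mono) simp
  moreover have "v \<bullet> (W *v v) \<le> norm v * norm (W *v v)" by (rule norm_cauchy_schwarz)
  ultimately show ?thesis by (simp add: power2_eq_square mult_ac)
qed

section \<open>Normalising a positive definite matrix\<close>

definition compress :: "complex^'d^'d \<Rightarrow> complex^'d^'d \<Rightarrow> complex^'d^'d" where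
  "compress C V = adj C ** V ** C"

lemma compress_form: "w \<bullet> (compress C V *v w) = (C *v w) \<bullet> (V *v (C *v w))"
  by (simp add: compress_def inner_adj flip: matrix_vector_mul_assoc)

lemma pos_semidef_compress: "pos_semidef V \<Longrightarrow> pos_semidef (compress C V)"
  unfolding pos_semidef_def compress_form hermitian_iff_adj
  by (simp add: compress_def adj_mult matrix_mul_assoc)

lemma rtrace_compress: "rtrace (compress C V) = (\<Sum>k\<in>UNIV. column k C \<bullet> (V *v column k C))"
  unfolding rtrace_def
proof (rule sum.cong)
  fix k :: 'a
  have "Re (compress C V $ k $ k) = axis k 1 \<bullet> (compress C V *v axis k 1)"
    by (simp add: inner_axis_mv)
  also have "C *v axis k 1 = column k C"
    by (simp add: vec_eq_iff mv_axis column_def)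
  then have "axis k 1 \<bullet> (compress C V *v axis k 1) = column k C \<bullet> (V *v column k C)"
    by (simp add: compress_form)
  finally show "Re (compress C V $ k $ k) = column k C \<bullet> (V *v column k C)" .
qed simp

lemma rdet_compress: "rdet (compress C V) = (cmod (det C))\<^sup>2 * rdet V"
proof -
  have "det (compress C V) = (det C * cnj (det C)) * det V"
    by (simp add: compress_def det_mul det_adj mult_ac)
  also have "\<dots> = of_real ((cmod (det C))\<^sup>2) * det V"
    by (simp only: complex_norm_square)
  finally show ?thesis by (simp add: rdet_def)
qed

text \<open>The columns of \<open>C\<close> form an approximate Auerbach basis for the norm defined by \<open>M\<close>: the form
  \<open>compress C M\<close> has diagonal at most \<open>1\<close> and is at least \<open>1/d\<close> times the identity.\<close>

definition auerbach :: "complex^'d^'d \<Rightarrow> complex^'d^'d \<Rightarrow> bool" where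
  "auerbach M C \<longleftrightarrow> det C \<noteq> 0 \<and> (\<forall>k. column k C \<bullet> (M *v column k C) \<le> 1) \<and>
     (\<forall>w. (norm w)\<^sup>2 \<le> real CARD('d) * ((C *v w) \<bullet> (M *v (C *v w))))"

text \<open>Take \<open>C\<close> with columns in the compact ellipsoid of \<open>M\<close> and \<open>|det C|\<close> maximal. If \<open>C w\<close> lies in the ellipsoid, then
  replacing column \<open>k\<close> of \<open>C\<close> by \<open>C w\<close> multiplies the determinant by \<open>w\<^sub>k\<close> (Cramer), so \<open>|w\<^sub>k| \<le> 1\<close>.
  The bound on \<open>norm w\<close> for general \<open>w\<close> follows by homogeneity.\<close>

lemma exists_auerbach:
  fixes M :: "complex^'d^'d"
  assumes M: "pos_def M"
  shows "\<exists>C. auerbach M C"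
proof -
  define q where "q v = v \<bullet> (M *v v)" for v
  have q_pos: "0 < q v" if "v \<noteq> 0" for v using M that by (simp add: q_def pos_def_def)
  have q_nonneg: "0 \<le> q v" for v using pos_def_imp_psd[OF M] by (simp add: q_def pos_semidef_def)
  have q_scale: "q (s *\<^sub>R v) = s\<^sup>2 * q v" for s v by (simp add: q_def mv_scaleR power2_eq_square)
  have q_cont: "continuous_on S (\<lambda>x. q (f x))" if "continuous_on S f" for f :: "'t::topological_space \<Rightarrow> complex^'d" and S
  proof -
    have "continuous_on S (\<lambda>x. f x $ i)" for i by (rule continuous_on_component[OF that])
    then show ?thesis
      unfolding q_def inner_vec_def matrix_vector_mult_def vec_lambda_beta
      by (intro continuous_on_sum continuous_on_inner continuous_on_mult[OF continuous_on_const])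
  qed
  obtain c where c: "0 < c" "\<And>v. c * (norm v)\<^sup>2 \<le> q v"
  proof -
    have "sphere (0 :: complex^'d) 1 \<noteq> {}"
    proof -
      have "axis undefined 1 \<in> sphere (0 :: complex^'d) 1" by (simp add: norm_eq_sqrt_inner inner_axis_axis)
      then show ?thesis by blast
    qed
    then obtain u where u: "u \<in> sphere 0 1" "\<And>v. v \<in> sphere 0 1 \<Longrightarrow> q u \<le> q v"
      using continuous_attains_inf[OF compact_sphere _ q_cont[OF continuous_on_id], of 0 1] by auto
    have "u \<noteq> 0" using u(1) by auto
    have "q u * (norm v)\<^sup>2 \<le> q v" for v
    proof (cases "v = 0")
      case False
      then have "q u \<le> q ((1 / norm v) *\<^sub>R v)" by (intro u(2)) simp
      then have "q u \<le> (1 / norm v)\<^sup>2 * q v" unfolding q_scale .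
      then show ?thesis using False by (simp add: power_divide pos_le_divide_eq)
    qed (use q_nonneg in simp)
    then show thesis using that q_pos[OF \<open>u \<noteq> 0\<close>] by blast
  qed
  define K where "K = {C :: complex^'d^'d. \<forall>j. q (column j C) \<le> 1}"
  have col_cont: "continuous_on S (\<lambda>C :: complex^'d^'d. column j C)" for S j
    unfolding column_def by (intro continuous_on_vec_lambda continuous_on_component continuous_on_id)
  have "closed K" unfolding K_def
    by (intro closed_Collect_all closed_Collect_le q_cont col_cont continuous_on_const)
  moreover have "bounded K"
  proof -
    have "norm C \<le> (\<Sum>i\<in>(UNIV :: 'd set). \<Sum>j\<in>(UNIV :: 'd set). sqrt (1 / c))" if "C \<in> K" for C
    proof -
      have entry: "cmod (C $ i $ j) \<le> sqrt (1 / c)" for i j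
      proof -
        have "c * (norm (column j C))\<^sup>2 \<le> 1" 
        proof -
          have "q (column j C) \<le> 1" using that unfolding K_def by blast
          then show ?thesis using c(2)[of "column j C"] by linarith
        qed
        then have "(norm (column j C))\<^sup>2 \<le> 1 / c" using c(1) by (simp add: field_simps)
        then have "norm (column j C) \<le> sqrt (1 / c)" by (rule real_le_rsqrt)
        moreover have "cmod (C $ i $ j) \<le> norm (column j C)"
          using Finite_Cartesian_Product.norm_nth_le[of "column j C" i] by (simp add: column_def)
        ultimately show ?thesis by simp
      qed
      have "norm C \<le> (\<Sum>i\<in>UNIV. norm (C $ i))"
        unfolding norm_vec_def[of C] by (rule L2_set_le_sum) simp
      also have "\<dots> \<le> (\<Sum>i\<in>UNIV. \<Sum>j\<in>UNIV. cmod (C $ i $ j))"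
      proof (rule sum_mono)
        fix i show "norm (C $ i) \<le> (\<Sum>j\<in>UNIV. cmod (C $ i $ j))"
          unfolding norm_vec_def[of "C $ i"] by (rule L2_set_le_sum) simp
      qed
      also have "\<dots> \<le> (\<Sum>i\<in>(UNIV :: 'd set). \<Sum>j\<in>(UNIV :: 'd set). sqrt (1 / c))"
        by (intro sum_mono entry)
      finally show ?thesis .
    qed
    then show ?thesis unfolding bounded_iff by blast
  qed
  ultimately have "compact K" by (simp add: compact_eq_bounded_closed)
  \<comment> \<open>A small multiple of the identity shows that the maximal determinant is not zero.\<close>
  define S where "S = 1 + (\<Sum>j\<in>UNIV. q (axis j 1))"
  have S: "0 < S" "q (axis j 1) \<le> S" for j
  proof -
    have "q (axis j 1) \<le> (\<Sum>j\<in>UNIV. q (axis j 1))" by (rule member_le_sum) (use q_nonneg in auto)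
    then show "0 < S" "q (axis j 1) \<le> S" using q_nonneg[of "axis j 1"] by (auto simp: S_def)
  qed
  define C0 where "C0 = (1 / sqrt S) *\<^sub>R (mat 1 :: complex^'d^'d)"
  have "C0 \<in> K"
  proof -
    have "column j C0 = (1 / sqrt S) *\<^sub>R axis j 1" for j
      by (simp add: C0_def column_def vec_eq_iff axis_def mat_def)
    then have "q (column j C0) = q (axis j 1) / S" for j
      using S(1) by (simp add: q_scale power_divide)
    then show ?thesis using S by (simp add: K_def)
  qed
  have "det C0 \<noteq> 0"
  proof -
    have "det C0 = (\<Prod>i\<in>(UNIV :: 'd set). C0 $ i $ i)"
      by (rule det_diagonal) (simp add: C0_def mat_def)
    then show ?thesis using S(1) by (simp add: C0_def mat_def)
  qed
  obtain C where C: "C \<in> K" "\<And>B. B \<in> K \<Longrightarrow> cmod (det B) \<le> cmod (det C)"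
    using continuous_attains_sup[OF \<open>compact K\<close>, of "\<lambda>C. cmod (det C)"] \<open>C0 \<in> K\<close>
      continuous_on_norm[OF continuous_on_det[OF continuous_on_id]] by blast
  have "det C \<noteq> 0" using C(2)[OF \<open>C0 \<in> K\<close>] \<open>det C0 \<noteq> 0\<close> by auto
  have comp: "cmod (w $ k) \<le> 1" if "q (C *v w) \<le> 1" for w k
  proof -
    let ?A = "(\<chi> i j. if j = k then (C *v w) $ i else C $ i $ j) :: complex^'d^'d"
    have "column j ?A = (if j = k then C *v w else column j C)" for j
      by (simp add: column_def vec_eq_iff)
    then have "?A \<in> K" using C(1) that by (simp add: K_def)
    then have "cmod (det ?A) \<le> cmod (det C)" by (rule C(2))
    then show ?thesis unfolding cramer_lemma using \<open>det C \<noteq> 0\<close> by (simp add: norm_mult)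
  qed
  have unit: "(norm w)\<^sup>2 \<le> real CARD('d)" if "q (C *v w) \<le> 1" for w
  proof -
    have "(norm w)\<^sup>2 = (\<Sum>k\<in>UNIV. (cmod (w $ k))\<^sup>2)"
      by (simp add: norm_vec_def L2_set_def sum_nonneg)
    also have "\<dots> \<le> (\<Sum>k\<in>(UNIV :: 'd set). 1)"
      by (intro sum_mono) (use comp[OF that] in \<open>simp add: power_le_one\<close>)
    finally show ?thesis by simp
  qed
  have "(norm w)\<^sup>2 \<le> real CARD('d) * q (C *v w)" for w
  proof (cases "w = 0")
    case False
    have "inj ((*v) C)"
      using \<open>det C \<noteq> 0\<close> invertible_eq_bij[of C] invertible_det_nz[of C] by (simp add: bij_is_inj)
    then have "C *v w \<noteq> 0" using False injD[of "(*v) C" w 0] by auto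
    then have r: "0 < q (C *v w)" by (rule q_pos)
    define s where "s = 1 / sqrt (q (C *v w))"
    have s2: "s\<^sup>2 = 1 / q (C *v w)" using r by (simp add: s_def power_divide)
    have "q (C *v (s *\<^sub>R w)) \<le> 1" using r by (simp add: mv_scaleR q_scale s2)
    then have "(norm (s *\<^sub>R w))\<^sup>2 \<le> real CARD('d)" by (rule unit)
    then have "(norm w)\<^sup>2 / q (C *v w) \<le> real CARD('d)" by (simp add: power_mult_distrib s2)
    then show ?thesis using r by (simp add: pos_divide_le_eq)
  qed (use q_nonneg in simp)
  then have "auerbach M C"
    using \<open>det C \<noteq> 0\<close> C(1) by (simp add: auerbach_def K_def q_def)
  then show ?thesis ..
qed

text \<open>The comparisons between \<open>V\<close> and \<open>M\<close>. All constants depend on the dimension only, which makes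
  the estimates on cubes uniform.\<close>

context
  fixes M C :: "complex^'d^'d"
  assumes M: "pos_def M" and C: "auerbach M C"
begin

lemma rtrace_compress_self: "rtrace (compress C M) \<le> real CARD('d)"
  unfolding rtrace_compress using C sum_mono[of UNIV "\<lambda>k. column k C \<bullet> (M *v column k C)" "\<lambda>_. 1"]
  by (simp add: auerbach_def)

lemma det_C_pos: "0 < (cmod (det C))\<^sup>2"
  using C by (simp add: auerbach_def)

lemma rdet_compress_self_le: "rdet (compress C M) \<le> fact CARD('d) * (2 * real CARD('d)) ^ CARD('d)"
proof -
  have psd: "pos_semidef (compress C M)" by (rule pos_semidef_compress[OF pos_def_imp_psd[OF M]])
  have nn: "0 \<le> rtrace (compress C M)"
    unfolding rtrace_compress using pos_def_imp_psd[OF M] by (intro sum_nonneg) (simp add: pos_semidef_def)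
  have "rdet (compress C M) \<le> fact CARD('d) * (2 * rtrace (compress C M)) ^ CARD('d)"
    by (rule pos_semidef_rdet_le[OF psd])
  also have "\<dots> \<le> fact CARD('d) * (2 * real CARD('d)) ^ CARD('d)"
    using rtrace_compress_self nn by (intro mult_left_mono power_mono) auto
  finally show ?thesis .
qed

lemma rdet_compress_self_ge: "1 \<le> fact CARD('d) * real CARD('d) ^ CARD('d) * rdet (compress C M)"
proof -
  have psd: "pos_semidef (compress C M)" by (rule pos_semidef_compress[OF pos_def_imp_psd[OF M]])
  have "(1 / real CARD('d)) ^ CARD('d) \<le> fact CARD('d) * rdet (compress C M)"
    by (rule rdet_ge_of_coercive[OF psd])
       (use C in \<open>auto simp: auerbach_def compress_form pos_divide_le_eq mult.commute\<close>)
  then have "(1 / real CARD('d)) ^ CARD('d) * real CARD('d) ^ CARD('d)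
      \<le> fact CARD('d) * rdet (compress C M) * real CARD('d) ^ CARD('d)"
    by (intro mult_right_mono) auto
  then show ?thesis by (simp add: mult_ac flip: power_mult_distrib)
qed

lemma rdet_le_rtrace_compress:
  assumes V: "pos_semidef V"
  shows "rdet V \<le> (fact CARD('d))\<^sup>2 * (2 * real CARD('d)) ^ CARD('d) * rdet M * rtrace (compress C V) ^ CARD('d)"
proof -
  define k where "k = (cmod (det C))\<^sup>2"
  define f where "f = (fact CARD('d) :: real)"
  define d where "d = real CARD('d)"
  define t where "t = rtrace (compress C V)"
  have k: "0 < k" using det_C_pos by (simp add: k_def)
  have t: "0 \<le> t" unfolding t_def rtrace_compress using V by (intro sum_nonneg) (simp add: pos_semidef_def)
  have f: "0 < f" "0 < d" by (simp_all add: f_def d_def)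
  have "k * rdet V \<le> f * (2 * t) ^ CARD('d)"
    using pos_semidef_rdet_le[OF pos_semidef_compress[OF V], of C] by (simp add: rdet_compress k_def f_def t_def)
  also have "\<dots> = f * (2 * t) ^ CARD('d) * 1" by simp
  also have "\<dots> \<le> f * (2 * t) ^ CARD('d) * (f * d ^ CARD('d) * (k * rdet M))"
    using rdet_compress_self_ge f t by (intro mult_left_mono) (auto simp: rdet_compress k_def f_def d_def)
  also have "\<dots> = k * (f\<^sup>2 * (2 * d) ^ CARD('d) * rdet M * t ^ CARD('d))"
    by (simp add: power_mult_distrib power2_eq_square mult_ac)
  finally show ?thesis using k by (simp add: f_def d_def t_def)
qed

lemma rdet_ge_of_form_le:
  assumes V: "pos_semidef V" and \<delta>: "0 < \<delta>" and le: "form_le (\<delta> *\<^sub>R M) V"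
  shows "\<delta> ^ CARD('d) * rdet M \<le> (fact CARD('d))\<^sup>2 * (2 * (real CARD('d))\<^sup>2) ^ CARD('d) * rdet V"
proof -
  define k where "k = (cmod (det C))\<^sup>2"
  define f where "f = (fact CARD('d) :: real)"
  define d where "d = real CARD('d)"
  have k: "0 < k" using det_C_pos by (simp add: k_def)
  have f: "0 < f" "0 < d" by (simp_all add: f_def d_def)
  have "(\<delta> / d) ^ CARD('d) \<le> f * rdet (compress C V)"
    unfolding f_def
  proof (rule rdet_ge_of_coercive[OF pos_semidef_compress[OF V]])
    show "0 < \<delta> / d" using \<delta> f by simp
    fix w :: "complex^'d"
    have "(norm w)\<^sup>2 / d \<le> (C *v w) \<bullet> (M *v (C *v w))"
      using C f by (simp add: auerbach_def d_def pos_divide_le_eq mult.commute)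
    then have "\<delta> * ((norm w)\<^sup>2 / d) \<le> \<delta> * ((C *v w) \<bullet> (M *v (C *v w)))"
      using \<delta> by (intro mult_left_mono) auto
    also have "\<dots> = (C *v w) \<bullet> ((\<delta> *\<^sub>R M) *v (C *v w))" by (simp add: scaleR_mv)
    also have "\<dots> \<le> (C *v w) \<bullet> (V *v (C *v w))" using le unfolding form_le_def by blast
    finally show "\<delta> / d * (norm w)\<^sup>2 \<le> w \<bullet> (compress C V *v w)" by (simp add: compress_form)
  qed
  then have a: "\<delta> ^ CARD('d) \<le> d ^ CARD('d) * (f * (k * rdet V))"
    using f by (simp add: power_divide pos_divide_le_eq rdet_compress k_def mult_ac)
  have M': "k * rdet M \<le> f * (2 * d) ^ CARD('d)"
    using rdet_compress_self_le by (simp add: rdet_compress k_def f_def d_def)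
  have "0 \<le> k * rdet M" using k pos_def_rdet_pos[OF M] by simp
  then have "\<delta> ^ CARD('d) * (k * rdet M) \<le> (d ^ CARD('d) * (f * (k * rdet V))) * (f * (2 * d) ^ CARD('d))"
    by (intro mult_mono[OF a M']) (use f k pos_semidef_rdet_nonneg[OF V] in simp_all)
  also have "\<dots> = k * (f\<^sup>2 * (2 * d\<^sup>2) ^ CARD('d) * rdet V)"
    by (simp add: power_mult_distrib power2_eq_square mult_ac)
  finally have "k * (\<delta> ^ CARD('d) * rdet M) \<le> k * (f\<^sup>2 * (2 * d\<^sup>2) ^ CARD('d) * rdet V)"
    by (simp only: mult_ac)
  then show ?thesis using k by (simp add: f_def d_def)
qed

lemma form_le_of_rdet:
  fixes t :: real
  assumes V: "pos_semidef V" and D: "0 < rdet V" and t: "rtrace (compress C V) \<le> t" "0 < t"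
  shows "form_le ((rdet V / rdet M / (2 * (fact CARD('d))\<^sup>2 * real CARD('d) ^ (CARD('d) + 4) * (2 * t) ^ (CARD('d) - 1))) *\<^sub>R M) V"
  unfolding form_le_def
proof
  fix v :: "complex^'d"
  define k where "k = (cmod (det C))\<^sup>2"
  define f where "f = (fact CARD('d) :: real)"
  define d where "d = real CARD('d)"
  define T where "T = (2 * t) ^ (CARD('d) - 1)"
  have k: "0 < k" using det_C_pos by (simp add: k_def)
  have f: "0 < f" "0 < d" "0 < T" using t by (simp_all add: f_def d_def T_def)
  have Mp: "0 < rdet M" by (rule pos_def_rdet_pos[OF M])
  have "surj ((*v) C)"
    using C invertible_eq_bij[of C] invertible_det_nz[of C] by (simp add: bij_is_surj auerbach_def)
  then obtain w where w: "v = C *v w" by blast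
  have vVv: "v \<bullet> (V *v v) = w \<bullet> (compress C V *v w)" by (simp add: compress_form w)
  have lower: "k * rdet V * (norm w)\<^sup>2 \<le> d * f * T * (v \<bullet> (V *v v))"
    using form_ge_of_rdet[OF pos_semidef_compress[OF V] _ t(1), of w] k D
    by (simp add: rdet_compress vVv k_def d_def f_def T_def)
  have "cmod (compress C M $ i $ j) \<le> 2 * d" for i j
    using pos_semidef_entry[OF pos_semidef_compress[OF pos_def_imp_psd[OF M]], of C i j] rtrace_compress_self
    by (simp add: d_def)
  then have upper: "v \<bullet> (M *v v) \<le> 2 * d ^ 3 * (norm w)\<^sup>2"
    using form_le_entry_bound[of "compress C M" "2 * d" w]
    by (simp add: compress_form w d_def power3_eq_cube power2_eq_square mult_ac)
  have one: "1 \<le> f * d ^ CARD('d) * (k * rdet M)"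
    using rdet_compress_self_ge by (simp add: rdet_compress k_def f_def d_def)
  have Mv: "0 \<le> v \<bullet> (M *v v)" using pos_def_imp_psd[OF M] by (simp add: pos_semidef_def)
  have "rdet V * (v \<bullet> (M *v v)) * 1 \<le> rdet V * (v \<bullet> (M *v v)) * (f * d ^ CARD('d) * (k * rdet M))"
    using D Mv by (intro mult_left_mono one) auto
  also have "\<dots> = (f * d ^ CARD('d) * rdet M * (k * rdet V)) * (v \<bullet> (M *v v))" by (simp add: mult_ac)
  also have "\<dots> \<le> (f * d ^ CARD('d) * rdet M * (k * rdet V)) * (2 * d ^ 3 * (norm w)\<^sup>2)"
    using f k D Mp by (intro mult_left_mono upper) auto
  also have "\<dots> = (2 * f * d ^ CARD('d) * d ^ 3 * rdet M) * (k * rdet V * (norm w)\<^sup>2)" by (simp add: mult_ac)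
  also have "\<dots> \<le> (2 * f * d ^ CARD('d) * d ^ 3 * rdet M) * (d * f * T * (v \<bullet> (V *v v)))"
    using f Mp by (intro mult_left_mono lower) auto
  also have "\<dots> = (rdet M * (2 * f\<^sup>2 * d ^ (CARD('d) + 4) * T)) * (v \<bullet> (V *v v))"
    by (simp add: power2_eq_square power_add power3_eq_cube power4_eq_xxxx mult_ac)
  finally have main: "rdet V * (v \<bullet> (M *v v)) \<le> (rdet M * (2 * f\<^sup>2 * d ^ (CARD('d) + 4) * T)) * (v \<bullet> (V *v v))"
    by simp
  define Z where "Z = 2 * f\<^sup>2 * d ^ (CARD('d) + 4) * T"
  have Z: "0 < Z" using f by (simp add: Z_def)
  have "rdet V / rdet M / Z * (v \<bullet> (M *v v)) \<le> v \<bullet> (V *v v)"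
    using main Z Mp unfolding Z_def[symmetric] by (simp add: field_simps)
  then show "v \<bullet> ((rdet V / rdet M / (2 * (fact CARD('d))\<^sup>2 * real CARD('d) ^ (CARD('d) + 4) * (2 * t) ^ (CARD('d) - 1))) *\<^sub>R M *v v)
      \<le> v \<bullet> (V *v v)"
    by (simp add: scaleR_mv Z_def f_def d_def T_def)
qed

end

section \<open>Closed cubes and extended averages of logarithms\<close>

lemma cubeE:
  fixes Q :: "(real^'n) set"
  assumes "cube Q"
  obtains a l where "0 < l" "Q = cbox a (\<chi> i. a $ i + l)" "Q \<in> lmeasurable" "compact Q" "0 < measure lebesgue Q"
    "measure lebesgue (hcube a l) = measure lebesgue Q" "hcube a l \<subseteq> Q"
    "sym_diff (hcube a l) Q \<in> null_sets lebesgue"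
proof -
  obtain a l where al: "0 < l" "Q = cbox a (\<chi> i. a $ i + l)" using assms unfolding cube_def by blast
  have m: "measure lebesgue (hcube a l) = measure lebesgue Q" by (simp only: al(2) measure_hcube_cbox)
  have "0 < measure lebesgue (hcube a l)" using al(1) by (simp add: measure_hcube)
  then have p: "0 < measure lebesgue Q" by (simp only: m)
  show thesis
    by (rule that[OF al _ _ p m]) (unfold al(2), auto simp: lmeasurable_cbox compact_cbox hcube_between(2) intro: hcube_sym_diff_null)
qed

lemma average_null_delta:
  fixes w :: "real^'n \<Rightarrow> real"
  assumes "w \<in> borel_measurable lebesgue" "A \<in> sets lebesgue" "B \<in> sets lebesgue"
    and "sym_diff A B \<in> null_sets lebesgue" "measure lebesgue A = measure lebesgue B"
  shows "average A w = average B w"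
proof -
  have "AE x in lebesgue. x \<notin> sym_diff A B" using assms(4) by (rule AE_not_in)
  then have "AE x in lebesgue. x \<in> A \<longleftrightarrow> x \<in> B" by (rule AE_mp) (auto intro!: AE_I2)
  then have "(LINT x:A|lebesgue. w x) = (LINT x:B|lebesgue. w x)"
    using assms(1-3) by (intro set_integral_cong_set) (auto simp: set_borel_measurable_def)
  then show ?thesis by (simp add: average_def assms(5))
qed

text \<open>Finiteness of the negative part forces \<open>g > 0\<close> almost everywhere on \<open>Q\<close>, after which the extended
  average and the Bochner average of the logarithm agree.\<close>

lemma ext_average_ext_ln:
  fixes g :: "real^'n \<Rightarrow> real"
  assumes g: "g \<in> borel_measurable lebesgue" "\<And>x. 0 \<le> g x" and Q: "Q \<in> sets lebesgue" "0 < measure lebesgue Q"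
    and P: "(\<integral>\<^sup>+x\<in>Q. e2ennreal (ext_ln (g x)) \<partial>lebesgue) < \<infinity>"
    and N: "(\<integral>\<^sup>+x\<in>Q. e2ennreal (- ext_ln (g x)) \<partial>lebesgue) < \<infinity>"
  shows "AE x in lebesgue. x \<in> Q \<longrightarrow> 0 < g x" "set_integrable lebesgue Q (\<lambda>x. ln (g x))"
    "ext_average Q (\<lambda>x. ext_ln (g x)) = ereal (average Q (\<lambda>x. ln (g x)))"
proof -
  have [measurable]: "g \<in> borel_measurable lebesgue" "Q \<in> sets lebesgue" using g(1) Q(1) by auto
  have eq: "e2ennreal (- ext_ln (g x)) = (if 0 < g x then ennreal (- ln (g x)) else \<infinity>)" for x
    by (simp add: ext_ln_def)
  have "(\<lambda>x. e2ennreal (- ext_ln (g x)) * indicator Q x) \<in> borel_measurable lebesgue"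
    unfolding eq by measurable
  then have "AE x in lebesgue. e2ennreal (- ext_ln (g x)) * indicator Q x \<noteq> \<infinity>"
    by (rule nn_integral_noteq_infinite) (use N in simp)
  then show pos: "AE x in lebesgue. x \<in> Q \<longrightarrow> 0 < g x"
  proof (rule AE_mp, intro AE_I2 impI)
    fix x assume a: "e2ennreal (- ext_ln (g x)) * indicator Q x \<noteq> \<infinity>" "x \<in> Q"
    show "0 < g x"
    proof (rule ccontr)
      assume "\<not> 0 < g x"
      then show False using a by (simp add: ext_ln_def)
    qed
  qed
  define f where "f x = indicator Q x * ln (g x)" for x
  have fm: "f \<in> borel_measurable lebesgue" unfolding f_def by measurable
  have Peq: "(\<integral>\<^sup>+x\<in>Q. e2ennreal (ext_ln (g x)) \<partial>lebesgue) = (\<integral>\<^sup>+x. ennreal (f x) \<partial>lebesgue)"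
    by (rule nn_integral_cong_AE, rule AE_mp[OF pos], intro AE_I2)
       (auto simp: f_def ext_ln_def indicator_def)
  have Neq: "(\<integral>\<^sup>+x\<in>Q. e2ennreal (- ext_ln (g x)) \<partial>lebesgue) = (\<integral>\<^sup>+x. ennreal (- f x) \<partial>lebesgue)"
    by (rule nn_integral_cong_AE, rule AE_mp[OF pos], intro AE_I2)
       (auto simp: f_def ext_ln_def indicator_def)
  have fi: "integrable lebesgue f"
    unfolding real_integrable_def using fm P N by (simp add: Peq Neq less_top)
  then show int: "set_integrable lebesgue Q (\<lambda>x. ln (g x))"
    by (simp add: set_integrable_def f_def[abs_def])
  obtain p where p: "0 \<le> p" "(\<integral>\<^sup>+x. ennreal (f x) \<partial>lebesgue) = ennreal p"
    using P unfolding Peq by (cases "\<integral>\<^sup>+x. ennreal (f x) \<partial>lebesgue" rule: ennreal_cases) auto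
  obtain q where q: "0 \<le> q" "(\<integral>\<^sup>+x. ennreal (- f x) \<partial>lebesgue) = ennreal q"
    using N unfolding Neq by (cases "\<integral>\<^sup>+x. ennreal (- f x) \<partial>lebesgue" rule: ennreal_cases) auto
  have "(LINT x:Q|lebesgue. ln (g x)) = p - q"
    unfolding set_lebesgue_integral_def
    using real_lebesgue_integral_def[OF fi] p q by (simp add: f_def[abs_def])
  then show "ext_average Q (\<lambda>x. ext_ln (g x)) = ereal (average Q (\<lambda>x. ln (g x)))"
    unfolding ext_average_def average_def Peq Neq p(2) q(2)
    using p(1) q(1) Q(2) by (simp add: enn2ereal_ennreal divide_ereal_def divide_inverse)
qed

lemma ext_average_finite_imp:
  assumes "(\<integral>\<^sup>+x\<in>Q. e2ennreal (f x) \<partial>lebesgue) < \<infinity>" "0 < measure lebesgue Q" "ext_average Q f \<noteq> -\<infinity>"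
  shows "(\<integral>\<^sup>+x\<in>Q. e2ennreal (- f x) \<partial>lebesgue) < \<infinity>"
proof (rule ccontr)
  assume "\<not> ?thesis"
  then have N: "(\<integral>\<^sup>+x\<in>Q. e2ennreal (- f x) \<partial>lebesgue) = \<infinity>" unfolding infinity_ennreal_def using less_top by blast
  obtain p where p: "0 \<le> p" "(\<integral>\<^sup>+x\<in>Q. e2ennreal (f x) \<partial>lebesgue) = ennreal p"
    using assms(1) by (cases "\<integral>\<^sup>+x\<in>Q. e2ennreal (f x) \<partial>lebesgue" rule: ennreal_cases) auto
  have "ext_average Q f = -\<infinity>"
    unfolding ext_average_def N p(2) using p(1) assms(2)
    by (simp add: enn2ereal_ennreal divide_ereal_def)
  then show False using assms(3) by simp
qed

lemma set_integrable_const: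
  fixes c :: real
  assumes "Q \<in> fmeasurable M" shows "set_integrable M Q (\<lambda>x. c)"
  unfolding set_integrable_def
  by (intro integrable_scaleR_left integrable_real_indicator) (use assms in \<open>auto simp: fmeasurable_def\<close>)

lemma set_integral_const_mult:
  fixes c :: real
  assumes "Q \<in> fmeasurable M" shows "(LINT x:Q|M. c) = c * measure M Q"
  using set_integral_const[of Q M c] fmeasurableD[OF assms] fmeasurableD2[OF assms]
  by (simp add: mult.commute)

lemma integral_le_of_nn_integral:
  assumes "integrable M f" "(\<integral>\<^sup>+x. ennreal (f x) \<partial>M) \<le> ennreal c" "0 \<le> c"
  shows "integral\<^sup>L M f \<le> c"
proof -
  have "integral\<^sup>L M f \<le> enn2real (\<integral>\<^sup>+x. ennreal (f x) \<partial>M)"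
    using real_lebesgue_integral_def[OF assms(1)] enn2real_nonneg[of "\<integral>\<^sup>+x. ennreal (- f x) \<partial>M"] by simp
  also have "\<dots> \<le> c" by (rule enn2real_leI[OF assms(3,2)])
  finally show ?thesis .
qed

lemma le_powr_root:
  fixes x K t :: real
  assumes "0 \<le> x" "0 \<le> K" "0 \<le> t" "x \<le> K * t ^ d" "0 < d"
  shows "x powr (1 / d) \<le> K powr (1 / d) * t"
proof -
  have t: "(t ^ d) powr (1 / d) = t"
    using assms by (cases "t = 0") (auto simp: powr_powr simp flip: powr_realpow)
  have "x powr (1 / d) \<le> (K * t ^ d) powr (1 / d)" using assms by (intro powr_mono2) auto
  also have "\<dots> = K powr (1 / d) * t" using assms by (simp add: powr_mult t)
  finally show ?thesis .
qed

lemma powr_root_power: "0 \<le> (x :: real) \<Longrightarrow> 0 < d \<Longrightarrow> (x powr (1 / real d)) ^ d = x"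
  by (cases "x = 0") (auto simp: powr_powr simp flip: powr_realpow)

lemma bounded_linear_form: "bounded_linear (\<lambda>W :: complex^'d^'d. v \<bullet> (W *v v))"
proof -
  have "linear (\<lambda>W :: complex^'d^'d. v \<bullet> (W *v v))"
    by (rule linearI) (simp_all add: matrix_vector_mult_add_rdistrib scaleR_mv inner_add_right)
  then show ?thesis by (simp add: linear_conv_bounded_linear)
qed

lemma bounded_linear_rtrace_compress: "bounded_linear (\<lambda>W :: complex^'d^'d. rtrace (compress C W))"
  unfolding rtrace_compress by (intro bounded_linear_sum bounded_linear_form)

lemma rtrace_compress_nonneg: "pos_semidef V \<Longrightarrow> 0 \<le> rtrace (compress C V)"
  unfolding rtrace_compress by (intro sum_nonneg) (simp add: pos_semidef_def)

text \<open>By continuity of the forms a countable dense set of vectors tests the order;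
  this yields measurability of the sets in the definition of the class \<open>A\<^sub>\<infinity>\<close>.\<close>

lemma form_le_countable:
  "\<exists>D :: (complex^'d) set. countable D \<and> D \<noteq> {} \<and>
     (\<forall>A B :: complex^'d^'d. form_le A B \<longleftrightarrow> (\<forall>v\<in>D. v \<bullet> (A *v v) \<le> v \<bullet> (B *v v)))"
proof -
  obtain D :: "(complex^'d) set" where D: "countable D" "\<And>X. open X \<Longrightarrow> X \<noteq> {} \<Longrightarrow> \<exists>d\<in>D. d \<in> X"
    using countable_dense_setE by blast
  have "form_le A B" if le: "\<forall>v\<in>D. v \<bullet> (A *v v) \<le> v \<bullet> (B *v v)" for A B :: "complex^'d^'d"
    unfolding form_le_def
  proof (rule allI, rule ccontr)
    fix v assume v: "\<not> v \<bullet> (A *v v) \<le> v \<bullet> (B *v v)"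
    have cont: "continuous_on UNIV (\<lambda>v. v \<bullet> (W *v v))" for W :: "complex^'d^'d"
    proof -
      have "continuous_on UNIV (\<lambda>x :: complex^'d. x $ i)" for i by (rule continuous_on_component[OF continuous_on_id])
      then show ?thesis
        unfolding inner_vec_def matrix_vector_mult_def vec_lambda_beta
        by (intro continuous_on_sum continuous_on_inner continuous_on_mult[OF continuous_on_const])
    qed
    have "open {v. v \<bullet> (B *v v) < v \<bullet> (A *v v)}" by (rule open_Collect_less[OF cont cont])
    then have "\<exists>d\<in>D. d \<in> {v. v \<bullet> (B *v v) < v \<bullet> (A *v v)}" by (rule D(2)) (use v in \<open>auto simp: not_le\<close>)
    then show False using le by force
  qed
  then have iff: "form_le A B \<longleftrightarrow> (\<forall>v\<in>D. v \<bullet> (A *v v) \<le> v \<bullet> (B *v v))" for A B :: "complex^'d^'d"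
    unfolding form_le_def by blast
  have "D \<noteq> {}" using D(2)[OF open_UNIV] by blast
  then show ?thesis using D(1) iff by blast
qed

section \<open>Matrix weights\<close>

context
  fixes V :: "real^'n \<Rightarrow> complex^'d^'d"
  assumes mw: "matrix_weight V"
begin

lemma psd: "pos_semidef (V x)"
  using mw by (simp add: matrix_weight_def)

lemma V_measurable [measurable]: "V \<in> borel_measurable lebesgue"
  using mw by (simp add: matrix_weight_def)

lemma bounded_linear_measurable:
  fixes L :: "complex^'d^'d \<Rightarrow> real"
  assumes "bounded_linear L" shows "(\<lambda>x. L (V x)) \<in> borel_measurable lebesgue"
  by (rule measurable_compose[OF V_measurable borel_measurable_continuous_onI])
     (rule bounded_linear.continuous_on[OF assms continuous_on_id])

lemma V_integrable: 
  assumes "compact K" shows "set_integrable lebesgue K V"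
proof -
  have K: "K \<in> sets lebesgue" using assms by (simp add: compact_imp_closed)
  have "set_integrable lebesgue K (\<lambda>x. norm (V x))" using mw assms by (simp add: matrix_weight_def)
  then have "integrable lebesgue (\<lambda>x. norm (indicator K x *\<^sub>R V x))"
    by (simp add: set_integrable_def)
  moreover have "(\<lambda>x. indicator K x *\<^sub>R V x) \<in> borel_measurable lebesgue"
    using K by (intro borel_measurable_scaleR borel_measurable_indicator V_measurable)
  ultimately show ?thesis unfolding set_integrable_def by (rule integrable_norm_cancel)
qed

lemma bounded_linear_integrable:
  fixes L :: "complex^'d^'d \<Rightarrow> real"
  assumes "bounded_linear L" "compact K" shows "set_integrable lebesgue K (\<lambda>x. L (V x))"
proof -
  have "integrable lebesgue (\<lambda>x. L (indicator K x *\<^sub>R V x))"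
    using V_integrable[OF assms(2)] unfolding set_integrable_def
    by (rule integrable_bounded_linear[OF assms(1)])
  then show ?thesis by (simp add: set_integrable_def linear_simps(5)[OF assms(1)])
qed

lemma average_bounded_linear:
  fixes L :: "complex^'d^'d \<Rightarrow> real"
  assumes "bounded_linear L" "compact K" shows "average K (\<lambda>x. L (V x)) = L (average K V)"
proof -
  have "(LINT x:K|lebesgue. L (V x)) = L (LINT x:K|lebesgue. V x)"
    using integral_bounded_linear[OF assms(1), of lebesgue "\<lambda>x. indicator K x *\<^sub>R V x"] V_integrable[OF assms(2)]
    by (simp add: set_integrable_def set_lebesgue_integral_def linear_simps(5)[OF assms(1)])
  then show ?thesis by (simp add: average_def linear_simps(5)[OF assms(1)])
qed

lemma rdet_measurable [measurable]: "(\<lambda>x. rdet (V x)) \<in> borel_measurable lebesgue"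
  by (rule measurable_compose[OF V_measurable borel_measurable_continuous_onI])
     (rule continuous_on_rdet[OF continuous_on_id])

lemma rdet_nonneg: "0 \<le> rdet (V x)"
  by (rule pos_semidef_rdet_nonneg[OF psd])

end

context
  fixes V :: "real^'n \<Rightarrow> complex^'d^'d"
  assumes mw: "matrix_weight V"
begin

lemma det_root_measurable: "(\<lambda>x. rdet (V x) powr (1 / CARD('d))) \<in> borel_measurable lebesgue"
  using rdet_measurable[OF mw] by measurable

text \<open>With \<open>M\<close> the average of \<open>V\<close> this is the pointwise form of Minkowski's determinant
  inequality, up to a constant: the right-hand side is linear in \<open>V\<close> and can be averaged.\<close>

lemma det_root_le_trace:
  assumes M: "pos_def M" and C: "auerbach M C"
  shows "rdet (V x) powr (1 / CARD('d))
    \<le> ((fact CARD('d))\<^sup>2 * (2 * real CARD('d)) ^ CARD('d)) powr (1 / CARD('d))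
       * rdet M powr (1 / CARD('d)) * rtrace (compress C (V x))"
proof -
  let ?K = "(fact CARD('d))\<^sup>2 * (2 * real CARD('d)) ^ CARD('d) :: real"
  have Mp: "0 < rdet M" by (rule pos_def_rdet_pos[OF M])
  have "rdet (V x) powr (1 / CARD('d)) \<le> (?K * rdet M) powr (1 / CARD('d)) * rtrace (compress C (V x))"
  proof (rule le_powr_root)
    show "rdet (V x) \<le> ?K * rdet M * rtrace (compress C (V x)) ^ CARD('d)"
      by (rule rdet_le_rtrace_compress[OF M C psd[OF mw]])
  qed (use Mp rdet_nonneg[OF mw] rtrace_compress_nonneg[OF psd[OF mw]] in simp_all)
  then show ?thesis using Mp by (simp add: powr_mult)
qed

lemma det_root_integrable:
  assumes "compact K"
  shows "set_integrable lebesgue K (\<lambda>x. rdet (V x) powr (1 / CARD('d)))"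
proof -
  have M: "pos_def (mat 1 :: complex^'d^'d)"
    by (auto simp: pos_def_def hermitian_def mat_def inner_self_mat1[unfolded mat_def])
  obtain C :: "complex^'d^'d" where C: "auerbach (mat 1) C" using exists_auerbach[OF M] by blast
  define k where "k = ((fact CARD('d))\<^sup>2 * (2 * real CARD('d)) ^ CARD('d)) powr (1 / CARD('d))
       * rdet (mat 1 :: complex^'d^'d) powr (1 / CARD('d))"
  have Ks: "K \<in> sets lebesgue" using assms by (simp add: compact_imp_closed)
  have int: "set_integrable lebesgue K (\<lambda>x. k * rtrace (compress C (V x)))"
    using bounded_linear_integrable[OF mw bounded_linear_rtrace_compress[of C] assms] by simp
  show ?thesis
  proof (rule set_integrable_bound[OF int])
    show "set_borel_measurable lebesgue K (\<lambda>x. rdet (V x) powr (1 / CARD('d)))"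
      unfolding set_borel_measurable_def
      by (intro borel_measurable_scaleR borel_measurable_indicator det_root_measurable Ks)
    show "AE x in lebesgue. x \<in> K \<longrightarrow> norm (rdet (V x) powr (1 / CARD('d)))
        \<le> norm (k * rtrace (compress C (V x)))"
    proof (intro AE_I2 impI)
      fix x
      have "rdet (V x) powr (1 / CARD('d)) \<le> k * rtrace (compress C (V x))"
        using det_root_le_trace[OF M C, of x] by (simp add: k_def)
      then show "norm (rdet (V x) powr (1 / CARD('d))) \<le> norm (k * rtrace (compress C (V x)))" by simp
    qed
  qed
qed

lemma det_root_scalar_weight: "scalar_weight (\<lambda>x. rdet (V x) powr (1 / CARD('d)))"
  unfolding scalar_weight_def using det_root_measurable det_root_integrable by simp

lemma form_le_set_measurable:
  assumes "Q \<in> lmeasurable"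
  shows "{x \<in> Q. form_le A (V x)} \<in> lmeasurable"
proof -
  obtain D :: "(complex^'d) set" where D: "countable D" "D \<noteq> {}"
    "\<And>A B :: complex^'d^'d. form_le A B \<longleftrightarrow> (\<forall>v\<in>D. v \<bullet> (A *v v) \<le> v \<bullet> (B *v v))"
    using form_le_countable by blast
  have "{x. v \<bullet> (A *v v) \<le> v \<bullet> (V x *v v)} \<in> sets lebesgue" for v
  proof -
    have "(\<lambda>x. v \<bullet> (V x *v v)) \<in> borel_measurable lebesgue"
      by (rule bounded_linear_measurable[OF mw bounded_linear_form])
    then have "{x \<in> space lebesgue. v \<bullet> (A *v v) \<le> v \<bullet> (V x *v v)} \<in> sets lebesgue"
      by (rule spec[OF borel_measurable_iff_ge[THEN iffD1]])
    then show ?thesis by simp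
  qed
  then have "(\<Inter>v\<in>D. {x. v \<bullet> (A *v v) \<le> v \<bullet> (V x *v v)}) \<in> sets lebesgue"
    using D(1,2) by (intro sets.countable_INT') auto
  moreover have "{x \<in> Q. form_le A (V x)} = Q \<inter> (\<Inter>v\<in>D. {x. v \<bullet> (A *v v) \<le> v \<bullet> (V x *v v)})"
    unfolding D(3) by blast
  ultimately show ?thesis using assms by (simp only: fmeasurable_Int_fmeasurable)
qed

lemma nn_integral_ext_ln_finite:
  assumes "compact Q"
  shows "(\<integral>\<^sup>+x\<in>Q. e2ennreal (ext_ln (rdet (V x))) \<partial>lebesgue) < \<infinity>"
proof -
  define w where "w x = rdet (V x) powr (1 / CARD('d))" for x
  have "e2ennreal (ext_ln (rdet (V x))) \<le> ennreal (CARD('d) * w x)" for x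
  proof (cases "0 < rdet (V x)")
    case True
    then have "0 < w x" by (simp add: w_def)
    then have "ln (w x) \<le> w x" by (rule order.strict_implies_order[OF ln_less_self])
    moreover have "ln (rdet (V x)) = CARD('d) * ln (w x)" using True by (simp add: w_def ln_powr)
    ultimately show ?thesis using True by (simp add: ext_ln_def ennreal_leI)
  qed (simp add: ext_ln_def e2ennreal_neg)
  then have "(\<integral>\<^sup>+x\<in>Q. e2ennreal (ext_ln (rdet (V x))) \<partial>lebesgue)
      \<le> (\<integral>\<^sup>+x. ennreal (norm (indicator Q x *\<^sub>R (CARD('d) * w x))) \<partial>lebesgue)"
    by (intro nn_integral_mono) (auto simp: indicator_def w_def abs_mult)
  also have "\<dots> < \<infinity>"
  proof -
    have "set_integrable lebesgue Q (\<lambda>x. CARD('d) * w x)"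
      using det_root_integrable[OF assms] unfolding w_def by (rule set_integrable_mult_right)
    then show ?thesis unfolding set_integrable_def integrable_iff_bounded by blast
  qed
  finally show ?thesis .
qed

context
  assumes ND: "class_ND V"
begin

lemma average_pos_def:
  assumes "cube Q" shows "pos_def (average Q V)"
proof -
  obtain a l where Q: "Q \<in> lmeasurable" "compact Q" "0 < measure lebesgue Q" using cubeE[OF assms] by metis
  have "0 < emeasure lebesgue Q" using Q by (simp add: emeasure_eq_measure2)
  then have pd: "pos_def (LINT x:Q|lebesgue. V x)"
    using ND V_integrable[OF mw Q(2)] Q(1) unfolding class_ND_def by (meson fmeasurableD)
  have "hermitian (c *\<^sub>R A)" if "hermitian A" for c and A :: "complex^'d^'d"
    unfolding hermitian_def
  proof (intro allI)
    fix i j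
    have "A $ i $ j = cnj (A $ j $ i)" using that unfolding hermitian_def by blast
    then show "(c *\<^sub>R A) $ i $ j = cnj ((c *\<^sub>R A) $ j $ i)" by simp
  qed
  then show ?thesis using pd Q(3) unfolding pos_def_def average_def by (simp add: scaleR_mv)
qed

text \<open>On the set where \<open>V \<ge> \<delta> M\<close> the weight \<open>w\<close> is at least a constant times \<open>r = (det M)\<^sup>1\<^sup>/\<^sup>d\<close>, and the average of \<open>w\<close> is at most
  a constant times \<open>r\<close>. So \<open>r\<close> and \<open>w\<^sub>Q\<close> are comparable, which is the reverse
  Brunn--Minkowski inequality, and the large set for \<open>V\<close> is a large set for \<open>w\<close>.\<close>

lemma Ainf_imp_RBM_and_scalar_Ainf:
  assumes Ainf: "class_Ainf V"
  shows "class_RBM V \<and> scalar_Ainf (\<lambda>x. rdet (V x) powr (1 / CARD('d)))"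
proof -
  define w where "w x = rdet (V x) powr (1 / CARD('d))" for x
  define K1 where "K1 = ((fact CARD('d))\<^sup>2 * (2 * real CARD('d)) ^ CARD('d)) powr (1 / CARD('d))"
  define K2 where "K2 = ((fact CARD('d))\<^sup>2 * (2 * (real CARD('d))\<^sup>2) ^ CARD('d)) powr (1 / CARD('d))"
  have K: "0 < K1" "0 < K2" by (simp_all add: K1_def K2_def)
  have w: "w \<in> borel_measurable lebesgue" "\<And>x. 0 \<le> w x"
    using det_root_measurable by (simp_all add: w_def[abs_def])
  \<comment> \<open>Minkowski: the average of the root is at most the root of the average, up to a constant.\<close>
  have upper: "average Q w \<le> K1 * CARD('d) * rdet (average Q V) powr (1 / CARD('d))" if Q: "cube Q" for Q
  proof -
    obtain a l where Q': "Q \<in> lmeasurable" "compact Q" "0 < measure lebesgue Q" using cubeE[OF Q] by metis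
    define M where "M = average Q V"
    define r where "r = rdet M powr (1 / CARD('d))"
    have M: "pos_def M" unfolding M_def by (rule average_pos_def[OF Q])
    obtain C where C: "auerbach M C" using exists_auerbach[OF M] by blast
    have "average Q w \<le> average Q (\<lambda>x. K1 * r * rtrace (compress C (V x)))"
    proof -
      have "(LINT x:Q|lebesgue. w x) \<le> (LINT x:Q|lebesgue. K1 * r * rtrace (compress C (V x)))"
        by (rule set_integral_mono)
           (use det_root_integrable[OF Q'(2)] bounded_linear_integrable[OF mw bounded_linear_rtrace_compress Q'(2)]
              det_root_le_trace[OF M C] in \<open>simp_all add: w_def K1_def r_def\<close>)
      then show ?thesis unfolding average_def using Q'(3) by (simp add: divide_right_mono)
    qed
    also have "\<dots> = K1 * r * average Q (\<lambda>x. rtrace (compress C (V x)))"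
      by (simp add: average_def)
    also have "\<dots> = K1 * r * rtrace (compress C M)"
      by (simp add: average_bounded_linear[OF mw bounded_linear_rtrace_compress Q'(2)] M_def)
    also have "\<dots> \<le> K1 * r * CARD('d)"
      using rtrace_compress_self[OF M C] K by (intro mult_left_mono) (auto simp: r_def)
    finally show ?thesis by (simp add: r_def M_def mult_ac)
  qed
  have lower: "\<delta> / K2 * rdet (average Q V) powr (1 / CARD('d)) \<le> w x"
    if Q: "cube Q" and \<delta>: "0 < \<delta>" and le: "form_le (\<delta> *\<^sub>R average Q V) (V x)" for Q \<delta> x
  proof -
    define M where "M = average Q V"
    have M: "pos_def M" unfolding M_def by (rule average_pos_def[OF Q])
    have Mp: "0 < rdet M" by (rule pos_def_rdet_pos[OF M])
    obtain C where C: "auerbach M C" using exists_auerbach[OF M] by blast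
    let ?K = "(fact CARD('d))\<^sup>2 * (2 * (real CARD('d))\<^sup>2) ^ CARD('d) :: real"
    have "rdet M * \<delta> ^ CARD('d) \<le> ?K * rdet (V x)"
      using rdet_ge_of_form_le[OF M C psd[OF mw] \<delta>] le by (simp add: M_def mult.commute)
    then have "(rdet M * \<delta> ^ CARD('d)) powr (1 / CARD('d)) \<le> (?K * rdet (V x)) powr (1 / CARD('d))"
      using Mp \<delta> by (intro powr_mono2) auto
    also have "\<dots> = K2 * w x"
      using rdet_nonneg[OF mw] by (simp add: powr_mult K2_def w_def)
    also have "(rdet M * \<delta> ^ CARD('d)) powr (1 / CARD('d)) = rdet M powr (1 / CARD('d)) * \<delta>"
    proof -
      have "(\<delta> ^ CARD('d)) powr (1 / CARD('d)) = \<delta>"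
        using \<delta> by (simp add: powr_powr flip: powr_realpow)
      then show ?thesis using Mp \<delta> by (simp add: powr_mult)
    qed
    finally show ?thesis using K by (simp add: M_def field_simps)
  qed
  have "class_RBM V"
  proof -
    obtain \<delta> where \<delta>: "0 < \<delta>" "\<And>Q. cube Q \<Longrightarrow>
        (1 - 1 / 2) * measure lebesgue Q \<le> measure lebesgue {x \<in> Q. form_le (\<delta> *\<^sub>R average Q V) (V x)}"
      using Ainf[unfolded class_Ainf_def, rule_format, of "1 / 2"] by auto
    have "rdet (average Q V) powr (1 / CARD('d)) \<le> 2 * K2 / \<delta> * average Q w" if Q: "cube Q" for Q
    proof -
      obtain a l where Q': "Q \<in> lmeasurable" "compact Q" "0 < measure lebesgue Q" using cubeE[OF Q] by metis
      define t where "t = \<delta> / K2 * rdet (average Q V) powr (1 / CARD('d))"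
      have t: "0 \<le> t" using \<delta> K by (simp add: t_def)
      have "{x \<in> Q. t \<le> w x} \<in> lmeasurable" by (rule lmeasurable_ge_set[OF w(1) Q'(1)])
      then have "measure lebesgue {x \<in> Q. form_le (\<delta> *\<^sub>R average Q V) (V x)} \<le> measure lebesgue {x \<in> Q. t \<le> w x}"
        using form_le_set_measurable[OF Q'(1)] lower[OF Q \<delta>(1)]
        by (intro measure_mono_fmeasurable) (auto simp: t_def fmeasurableD)
      then have "measure lebesgue Q / 2 \<le> measure lebesgue {x \<in> Q. t \<le> w x}" using \<delta>(2)[OF Q] by simp
      then have "t * (measure lebesgue Q / 2) \<le> t * measure lebesgue {x \<in> Q. t \<le> w x}"
        using t by (rule mult_left_mono)
      also have "\<dots> \<le> (LINT x:Q|lebesgue. w x)"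
        using det_root_integrable[OF Q'(2)] by (intro set_markov_inequality w Q'(1) t) (simp add: w_def[abs_def])
      also have "\<dots> = average Q w * measure lebesgue Q" by (rule mass_eq_average[OF Q'(3)])
      finally have "(t / 2) * measure lebesgue Q \<le> average Q w * measure lebesgue Q" by simp
      then have "t / 2 \<le> average Q w" by (rule mult_right_le_imp_le) (rule Q'(3))
      then show ?thesis using \<delta>(1) K by (simp add: t_def field_simps)
    qed
    then show ?thesis unfolding class_RBM_def using \<delta>(1) K
      by (intro exI[of _ "2 * K2 / \<delta>"]) (simp add: w_def[abs_def])
  qed
  moreover have "scalar_Ainf w"
    unfolding scalar_Ainf_def
  proof (intro conjI allI impI)
    show "scalar_weight w" using det_root_scalar_weight by (simp add: w_def[abs_def])
    fix \<epsilon> :: real assume "0 < \<epsilon>"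
    then obtain \<delta> where \<delta>: "0 < \<delta>" "\<And>Q. cube Q \<Longrightarrow>
        (1 - \<epsilon>) * measure lebesgue Q \<le> measure lebesgue {x \<in> Q. form_le (\<delta> *\<^sub>R average Q V) (V x)}"
      using Ainf[unfolded class_Ainf_def, rule_format, of \<epsilon>] by auto
    define \<eta> where "\<eta> = \<delta> / K2 / (K1 * CARD('d))"
    have \<eta>: "0 < \<eta>" using \<delta> K by (simp add: \<eta>_def)
    show "\<exists>\<delta>>0. \<forall>Q. cube Q \<longrightarrow> (1 - \<epsilon>) * measure lebesgue Q \<le> measure lebesgue {x \<in> Q. \<delta> * average Q w \<le> w x}"
    proof (intro exI[of _ \<eta>] conjI allI impI \<eta>)
      fix Q :: "(real^'n) set" assume Q: "cube Q"
      obtain a l where Q': "Q \<in> lmeasurable" using cubeE[OF Q] by metis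
      have meas: "{x \<in> Q. \<eta> * average Q w \<le> w x} \<in> lmeasurable" by (rule lmeasurable_ge_set[OF w(1) Q'])
      have "\<eta> * average Q w \<le> \<eta> * (K1 * CARD('d) * rdet (average Q V) powr (1 / CARD('d)))"
        using upper[OF Q] \<eta> by (intro mult_left_mono) auto
      also have "\<dots> = \<delta> / K2 * rdet (average Q V) powr (1 / CARD('d))"
        using K by (simp add: \<eta>_def)
      finally have "{x \<in> Q. form_le (\<delta> *\<^sub>R average Q V) (V x)} \<subseteq> {x \<in> Q. \<eta> * average Q w \<le> w x}"
        using lower[OF Q \<delta>(1)] by force
      then have "measure lebesgue {x \<in> Q. form_le (\<delta> *\<^sub>R average Q V) (V x)}
          \<le> measure lebesgue {x \<in> Q. \<eta> * average Q w \<le> w x}"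
        using meas fmeasurableD[OF form_le_set_measurable[OF Q']] by (intro measure_mono_fmeasurable)
      then show "(1 - \<epsilon>) * measure lebesgue Q \<le> measure lebesgue {x \<in> Q. \<eta> * average Q w \<le> w x}"
        using \<delta>(2)[OF Q] by linarith
    qed
  qed
  ultimately show ?thesis by (simp add: w_def[abs_def])
qed

end

end

text \<open>The passage from closed to half-open cubes and from the scalar \<open>A\<^sub>\<infinity>\<close> condition to the single
  inequality used for the decay.\<close>

lemma scalar_Ainf_log_deficit:
  fixes w :: "real^'n \<Rightarrow> real"
  assumes "scalar_Ainf w"
  obtains C where "0 \<le> C" "\<And>Q. cube Q \<Longrightarrow> 0 < average Q w \<Longrightarrow>
     (\<integral>\<^sup>+x\<in>Q. (if w x = 0 then \<infinity> else ennreal (ln (average Q w / w x))) \<partial>lebesgue)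
       \<le> ennreal (C * measure lebesgue Q)"
proof -
  have w: "w \<in> borel_measurable lebesgue" "\<And>x. 0 \<le> w x" "\<And>K. compact K \<Longrightarrow> set_integrable lebesgue K w"
    using assms by (auto simp: scalar_Ainf_def scalar_weight_def)
  define \<epsilon> where "\<epsilon> = 1 / (4 * 2 ^ CARD('n) :: real)"
  have "0 < \<epsilon>" by (simp add: \<epsilon>_def)
  then obtain \<delta>' where \<delta>': "0 < \<delta>'" "\<And>Q. cube Q \<Longrightarrow>
      (1 - \<epsilon>) * measure lebesgue Q \<le> measure lebesgue {x \<in> Q. \<delta>' * average Q w \<le> w x}"
    using assms unfolding scalar_Ainf_def by meson
  define \<delta> where "\<delta> = min \<delta>' 1"
  have \<delta>: "0 < \<delta>" "\<delta> \<le> 1" "\<delta> \<le> \<delta>'" using \<delta>' by (auto simp: \<delta>_def)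
  have cube_box: "cube (cbox a (\<chi> i. a $ i + l))" if "0 < l" for a :: "real^'n" and l
    using that unfolding cube_def by blast
  have avg: "average (hcube a l) w = average (cbox a (\<chi> i. a $ i + l)) w" for a l
    by (rule average_null_delta[OF w(1) _ _ hcube_sym_diff_null measure_hcube_cbox]) auto
  have int: "set_integrable lebesgue (hcube a l) w" for a l
    by (rule set_integrable_subset[OF w(3)[OF compact_cbox] _ hcube_between(2)]) simp
  have low: "{x \<in> Q. w x < t} \<in> lmeasurable" if "Q \<in> lmeasurable" for Q t
    by (rule lmeasurable_less_set[OF w(1) that])
  have thin: "measure lebesgue {x \<in> hcube a l. w x < \<delta> * average (hcube a l) w}
      \<le> measure lebesgue (hcube a l) / (4 * 2 ^ CARD('n))" if l: "0 < l" for a l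
  proof -
    define Q where "Q = cbox a (\<chi> i. a $ i + l)"
    define t where "t = \<delta>' * average Q w"
    have Qm: "Q \<in> lmeasurable" by (simp add: Q_def)
    have "0 \<le> average Q w" by (rule average_nonneg[OF w(2)])
    then have t: "\<delta> * average (hcube a l) w \<le> t"
      using \<delta> by (simp add: t_def avg Q_def mult_right_mono)
    have "measure lebesgue {x \<in> hcube a l. w x < \<delta> * average (hcube a l) w} \<le> measure lebesgue {x \<in> Q. w x < t}"
      by (rule measure_mono_fmeasurable[OF _ fmeasurableD[OF low[OF lmeasurable_hcube]] low[OF Qm]])
         (use t hcube_between(2)[of a l] in \<open>auto simp: Q_def\<close>)
    also have "\<dots> \<le> \<epsilon> * measure lebesgue Q"
    proof -
      have "(1 - \<epsilon>) * measure lebesgue Q \<le> measure lebesgue {x \<in> Q. t \<le> w x}"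
        unfolding Q_def t_def by (rule \<delta>'(2)[OF cube_box[OF l]])
      then show ?thesis
        using measure_split_at_level[OF w(1) Qm, of t] unfolding left_diff_distrib by linarith
    qed
    finally show ?thesis by (simp add: \<epsilon>_def measure_hcube_cbox Q_def)
  qed
  show thesis
  proof (rule that)
    have "1 \<le> 4 / \<delta>\<^sup>2" using \<delta> power_le_one[of \<delta> 2] by (simp add: pos_le_divide_eq)
    then show "0 \<le> 2 * ln (4 / \<delta>\<^sup>2)" by simp
    fix Q :: "(real^'n) set" assume Q: "cube Q" and pos: "0 < average Q w"
    obtain a l where al: "0 < l" "Q = cbox a (\<chi> i. a $ i + l)" "Q \<in> lmeasurable"
      "measure lebesgue (hcube a l) = measure lebesgue Q" "sym_diff (hcube a l) Q \<in> null_sets lebesgue"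
      using cubeE[OF Q] by metis
    have eq: "average (hcube a l) w = average Q w" by (simp add: avg al(2))
    have "0 < average (hcube a l) w" using pos by (simp only: eq)
    from nn_integral_log_deficit[OF w(1,2) int \<delta>(1,2) thin al(1) this]
    have "(\<integral>\<^sup>+x\<in>hcube a l. (if w x = 0 then \<infinity> else ennreal (ln (average Q w / w x))) \<partial>lebesgue)
       \<le> ennreal (2 * ln (4 / \<delta>\<^sup>2) * measure lebesgue Q)"
      unfolding eq al(4) .
    moreover have "(\<integral>\<^sup>+x\<in>hcube a l. (if w x = 0 then \<infinity> else ennreal (ln (average Q w / w x))) \<partial>lebesgue)
      = (\<integral>\<^sup>+x\<in>Q. (if w x = 0 then \<infinity> else ennreal (ln (average Q w / w x))) \<partial>lebesgue)"
      by (rule nn_integral_null_delta) (use al in auto)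
    ultimately show "(\<integral>\<^sup>+x\<in>Q. (if w x = 0 then \<infinity> else ennreal (ln (average Q w / w x))) \<partial>lebesgue)
       \<le> ennreal (2 * ln (4 / \<delta>\<^sup>2) * measure lebesgue Q)" by simp
  qed
qed

context
  fixes V :: "real^'n \<Rightarrow> complex^'d^'d"
  assumes mw: "matrix_weight V" and ND: "class_ND V"
begin

text \<open>With \<open>m = w\<^sub>Q\<close> the chain is \<open>(det M)\<^sup>1\<^sup>/\<^sup>d \<le> B m\<close> and \<open>ln m \<le> C +\<close> the average of \<open>ln w\<close>, where \<open>ln (det V) = d ln w\<close>;
  raising to the power \<open>d\<close> gives the constant \<open>B\<^sup>d exp (d C)\<close>.\<close>

lemma RBM_and_scalar_Ainf_imp_A2inf:
  assumes RBM: "class_RBM V" and Ainf: "scalar_Ainf (\<lambda>x. rdet (V x) powr (1 / CARD('d)))"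
  shows "class_A2inf V"
proof -
  define w where "w x = rdet (V x) powr (1 / CARD('d))" for x
  define d where "d = real CARD('d)"
  have d: "0 < d" by (simp add: d_def)
  obtain B where B: "0 < B" "\<And>Q. cube Q \<Longrightarrow> rdet (average Q V) powr (1 / CARD('d)) \<le> B * average Q w"
    using RBM unfolding class_RBM_def w_def by blast
  have "scalar_Ainf w" using Ainf by (simp add: w_def[abs_def])
  then obtain C where C: "0 \<le> C" "\<And>Q. cube Q \<Longrightarrow> 0 < average Q w \<Longrightarrow>
     (\<integral>\<^sup>+x\<in>Q. (if w x = 0 then \<infinity> else ennreal (ln (average Q w / w x))) \<partial>lebesgue)
       \<le> ennreal (C * measure lebesgue Q)"
    using scalar_Ainf_log_deficit by blast
  have g: "(\<lambda>x. rdet (V x)) \<in> borel_measurable lebesgue" "\<And>x. 0 \<le> rdet (V x)"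
    using rdet_measurable[OF mw] rdet_nonneg[OF mw] by auto
  have w: "w \<in> borel_measurable lebesgue" "\<And>x. 0 \<le> w x"
    using det_root_measurable[OF mw] by (simp_all add: w_def[abs_def])
  have w0: "w x = 0 \<longleftrightarrow> rdet (V x) = 0" for x by (simp add: w_def)
  have lnw: "ln (rdet (V x)) = d * ln (w x)" if "0 < rdet (V x)" for x
    using that by (simp add: w_def d_def ln_powr)
  have "ereal (rdet (average Q V)) \<le> ereal (B ^ CARD('d) * exp (d * C))
      * ext_exp (ext_average Q (\<lambda>x. ext_ln (rdet (V x))))" if Q: "cube Q" for Q
  proof -
    obtain a l where Q': "Q \<in> lmeasurable" "compact Q" "0 < measure lebesgue Q" using cubeE[OF Q] by metis
    have Qs: "Q \<in> sets lebesgue" using Q'(1) by (rule fmeasurableD)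
    define M where "M = average Q V"
    define m where "m = average Q w"
    define \<mu> where "\<mu> = measure lebesgue Q"
    have \<mu>: "0 < \<mu>" using Q'(3) by (simp add: \<mu>_def)
    have Mp: "0 < rdet M" unfolding M_def by (rule pos_def_rdet_pos[OF average_pos_def[OF mw ND Q]])
    have root: "rdet M powr (1 / CARD('d)) \<le> B * m" using B(2)[OF Q] by (simp add: M_def m_def)
    have "0 < rdet M powr (1 / CARD('d))" using Mp by simp
    then have "0 < B * m" using root by linarith
    then have m: "0 < m" using B(1) by (simp add: zero_less_mult_iff)
    define h :: "real^'n \<Rightarrow> ennreal" where "h x = (if w x = 0 then \<infinity> else ennreal (ln (m / w x)))" for x
    have hm: "h \<in> borel_measurable lebesgue" unfolding h_def using w(1) by measurable
    have h: "(\<integral>\<^sup>+x\<in>Q. h x \<partial>lebesgue) \<le> ennreal (C * \<mu>)"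
      using C(2)[OF Q m[unfolded m_def]] unfolding h_def m_def \<mu>_def .
    have P: "(\<integral>\<^sup>+x\<in>Q. e2ennreal (ext_ln (rdet (V x))) \<partial>lebesgue) < \<infinity>"
      by (rule nn_integral_ext_ln_finite[OF mw Q'(2)])
    have N: "(\<integral>\<^sup>+x\<in>Q. e2ennreal (- ext_ln (rdet (V x))) \<partial>lebesgue) < \<infinity>"
    proof -
      have pt: "e2ennreal (- ext_ln (rdet (V x))) \<le> ennreal (d * \<bar>ln m\<bar>) + ennreal d * h x" for x
      proof (cases "rdet (V x) = 0")
        case True
        then have "h x = \<infinity>" using w0[of x] by (simp add: h_def)
        then show ?thesis using d by (simp add: ennreal_mult_top)
      next
        case False
        then have gp: "0 < rdet (V x)" using g(2)[of x] by simp
        then have wp: "0 < w x" by (simp add: w_def)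
        have "- ln (rdet (V x)) = d * (- ln m) + d * ln (m / w x)"
          using lnw[OF gp] wp m by (simp add: ln_div algebra_simps)
        also have "\<dots> \<le> d * \<bar>ln m\<bar> + d * max 0 (ln (m / w x))"
          using d by (intro add_mono mult_left_mono) auto
        finally have "ennreal (- ln (rdet (V x))) \<le> ennreal (d * \<bar>ln m\<bar> + d * max 0 (ln (m / w x)))"
          by (rule ennreal_leI)
        also have "\<dots> = ennreal (d * \<bar>ln m\<bar>) + ennreal d * ennreal (max 0 (ln (m / w x)))"
          using d by (simp add: ennreal_mult)
        also have "ennreal (max 0 (ln (m / w x))) = h x" using wp by (simp add: h_def max_def ennreal_neg)
        finally show ?thesis using gp by (simp add: ext_ln_def)
      qed
      have "(\<integral>\<^sup>+x\<in>Q. e2ennreal (- ext_ln (rdet (V x))) \<partial>lebesgue)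
          \<le> (\<integral>\<^sup>+x. ennreal (d * \<bar>ln m\<bar>) * indicator Q x + ennreal d * (h x * indicator Q x) \<partial>lebesgue)"
        by (rule nn_integral_mono) (use pt in \<open>auto simp: indicator_def\<close>)
      also have "\<dots> = ennreal (d * \<bar>ln m\<bar>) * emeasure lebesgue Q + ennreal d * (\<integral>\<^sup>+x\<in>Q. h x \<partial>lebesgue)"
      proof -
        have "(\<lambda>x. h x * indicator Q x) \<in> borel_measurable lebesgue" using hm Qs by measurable
        then show ?thesis using Qs by (simp add: nn_integral_add nn_integral_cmult nn_integral_cmult_indicator)
      qed
      also have "\<dots> < \<infinity>"
      proof -
        have "(\<integral>\<^sup>+x\<in>Q. h x \<partial>lebesgue) < \<infinity>" using h by (rule le_less_trans) simp
        then show ?thesis using Q'(1) by (simp add: emeasure_eq_measure2 ennreal_mult_less_top)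
      qed
      finally show ?thesis .
    qed
    note ext = ext_average_ext_ln[OF g Qs Q'(3) P N]
    define A where "A = average Q (\<lambda>x. ln (rdet (V x)))"
    have lower: "d * ln m - d * C \<le> A"
    proof -
      define \<phi> where "\<phi> x = indicator Q x * (ln m - ln (rdet (V x)) / d)" for x
      have i1: "set_integrable lebesgue Q (\<lambda>x. ln (rdet (V x)) / d)" using ext(2) by simp
      have i2: "set_integrable lebesgue Q (\<lambda>x. ln m)"
        by (rule set_integrable_const[OF Q'(1)])
      have \<phi>i: "integrable lebesgue \<phi>"
        using set_integral_diff(1)[OF i2 i1] by (simp add: set_integrable_def \<phi>_def[abs_def])
      have "(\<integral>\<^sup>+x. ennreal (\<phi> x) \<partial>lebesgue) = (\<integral>\<^sup>+x\<in>Q. h x \<partial>lebesgue)"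
      proof (rule nn_integral_cong_AE, rule AE_mp[OF ext(1)], intro AE_I2 impI)
        fix x assume x: "x \<in> Q \<longrightarrow> 0 < rdet (V x)"
        show "ennreal (\<phi> x) = h x * indicator Q x"
        proof (cases "x \<in> Q")
          case True
          then have gp: "0 < rdet (V x)" using x by simp
          then have wp: "0 < w x" by (simp add: w_def)
          have "ln m - ln (rdet (V x)) / d = ln (m / w x)" using lnw[OF gp] d m wp by (simp add: ln_div)
          then show ?thesis using True wp by (simp add: \<phi>_def h_def)
        qed (simp add: \<phi>_def)
      qed
      then have "integral\<^sup>L lebesgue \<phi> \<le> C * \<mu>"
        using h C(1) \<mu> by (intro integral_le_of_nn_integral[OF \<phi>i]) simp_all
      moreover have "integral\<^sup>L lebesgue \<phi> = ln m * \<mu> - (LINT x:Q|lebesgue. ln (rdet (V x))) / d"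
      proof -
        have "integral\<^sup>L lebesgue \<phi> = (LINT x:Q|lebesgue. ln m - ln (rdet (V x)) / d)"
          by (simp add: set_lebesgue_integral_def \<phi>_def[abs_def])
        also have "\<dots> = (LINT x:Q|lebesgue. ln m) - (LINT x:Q|lebesgue. ln (rdet (V x)) / d)"
          by (rule set_integral_diff(2)[OF i2 i1])
        also have "(LINT x:Q|lebesgue. ln m) = ln m * \<mu>"
          unfolding \<mu>_def by (rule set_integral_const_mult[OF Q'(1)])
        finally show ?thesis by simp
      qed
      ultimately have "ln m * \<mu> - C * \<mu> \<le> (A * \<mu>) / d"
        using \<mu> by (simp add: A_def average_def \<mu>_def[symmetric])
      then have "(ln m * \<mu> - C * \<mu>) * d \<le> A * \<mu>" by (simp only: pos_le_divide_eq[OF d])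
      then have "(d * ln m - d * C) * \<mu> \<le> A * \<mu>" by (simp add: algebra_simps)
      then show ?thesis by (rule mult_right_le_imp_le) (rule \<mu>)
    qed
    have "rdet M = (rdet M powr (1 / CARD('d))) ^ CARD('d)"
      using Mp by (intro powr_root_power[symmetric]) auto
    also have "\<dots> \<le> (B * m) ^ CARD('d)" using root by (intro power_mono) auto
    also have "\<dots> = B ^ CARD('d) * exp (d * ln m)"
      using m by (simp add: power_mult_distrib d_def exp_of_nat_mult)
    also have "\<dots> \<le> B ^ CARD('d) * exp (d * C + A)"
      using lower B(1) by (intro mult_left_mono) auto
    also have "\<dots> = B ^ CARD('d) * exp (d * C) * exp A" by (simp add: exp_add)
    finally show ?thesis unfolding ext(3) A_def[symmetric] M_def[symmetric] by (simp add: ext_exp_def)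
  qed
  then show ?thesis
    unfolding class_A2inf_def using B(1) by (intro exI[of _ "B ^ CARD('d) * exp (d * C)"]) simp
qed

text \<open>Markov's inequality is applied once, to the sum of \<open>\<tau>\<close> and the nonnegative gap \<open>U\<close> between
  \<open>ln (det V / det M)\<close> and its upper bound \<open>|ln K| + d \<tau>\<close>; its average is at most \<open>R\<close>, whatever the cube.\<close>

lemma A2inf_imp_Ainf:
  assumes A2: "class_A2inf V"
  shows "class_Ainf V"
proof -
  define d where "d = real CARD('d)"
  define K where "K = (fact CARD('d))\<^sup>2 * (2 * d) ^ CARD('d)"
  have d: "0 < d" "1 \<le> d" by (simp_all add: d_def Suc_le_eq)
  have K: "0 < K" using d by (simp add: K_def)
  obtain A where A: "0 < A" "\<And>Q. cube Q \<Longrightarrow> ereal (rdet (average Q V))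
      \<le> ereal A * ext_exp (ext_average Q (\<lambda>x. ext_ln (rdet (V x))))"
    using A2 unfolding class_A2inf_def by blast
  define R where "R = \<bar>ln K\<bar> + d * d + \<bar>ln A\<bar> + d"
  have R: "0 < R" using d by (auto simp: R_def intro!: add_nonneg_pos)
  define Z where "Z s = 2 * (fact CARD('d))\<^sup>2 * d ^ (CARD('d) + 4) * (2 * s) ^ (CARD('d) - 1)" for s :: real
  have Z: "0 < Z s" if "0 < s" for s using that d by (simp add: Z_def)
  have g: "(\<lambda>x. rdet (V x)) \<in> borel_measurable lebesgue" "\<And>x. 0 \<le> rdet (V x)"
    using rdet_measurable[OF mw] rdet_nonneg[OF mw] by auto
  have main: "(1 - \<epsilon>) * measure lebesgue Q
      \<le> measure lebesgue {x \<in> Q. form_le ((exp (- (R / \<epsilon>)) / Z (R / \<epsilon>)) *\<^sub>R average Q V) (V x)}"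
    if \<epsilon>: "0 < \<epsilon>" and Q: "cube Q" for \<epsilon> Q
  proof -
    obtain a l where Q': "Q \<in> lmeasurable" "compact Q" "0 < measure lebesgue Q" using cubeE[OF Q] by metis
    have Qs: "Q \<in> sets lebesgue" using Q'(1) by (rule fmeasurableD)
    define \<mu> where "\<mu> = measure lebesgue Q"
    have \<mu>: "0 < \<mu>" using Q'(3) by (simp add: \<mu>_def)
    define s where "s = R / \<epsilon>"
    have s: "0 < s" using R \<epsilon> by (simp add: s_def)
    define M where "M = average Q V"
    have M: "pos_def M" unfolding M_def by (rule average_pos_def[OF mw ND Q])
    have Mp: "0 < rdet M" by (rule pos_def_rdet_pos[OF M])
    obtain C where C: "auerbach M C" using exists_auerbach[OF M] by blast
    define \<tau> where "\<tau> x = rtrace (compress C (V x))" for x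
    have \<tau>0: "0 \<le> \<tau> x" for x unfolding \<tau>_def by (rule rtrace_compress_nonneg[OF psd[OF mw]])
    have \<tau>i: "set_integrable lebesgue Q \<tau>"
      unfolding \<tau>_def by (rule bounded_linear_integrable[OF mw bounded_linear_rtrace_compress Q'(2)])
    have \<tau>m: "\<tau> \<in> borel_measurable lebesgue"
      unfolding \<tau>_def by (rule bounded_linear_measurable[OF mw bounded_linear_rtrace_compress])
    have \<tau>avg: "(LINT x:Q|lebesgue. \<tau> x) \<le> d * \<mu>"
    proof -
      have "average Q \<tau> \<le> d"
        unfolding \<tau>_def average_bounded_linear[OF mw bounded_linear_rtrace_compress Q'(2)]
        using rtrace_compress_self[OF M C] by (simp add: M_def d_def)
      then show ?thesis using mass_eq_average[OF Q'(3), of \<tau>] \<mu> by (simp add: \<mu>_def mult_right_mono)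
    qed
    \<comment> \<open>As \<open>det M > 0\<close>, the hypothesis excludes the value \<open>-\<infinity>\<close>, so \<open>ln (det V)\<close> is integrable on \<open>Q\<close>.\<close>
    define E where "E = ext_average Q (\<lambda>x. ext_ln (rdet (V x)))"
    have E: "ereal (rdet M) \<le> ereal A * ext_exp E" unfolding E_def M_def by (rule A(2)[OF Q])
    then have "E \<noteq> -\<infinity>" using Mp by (auto simp: ext_exp_def)
    have P: "(\<integral>\<^sup>+x\<in>Q. e2ennreal (ext_ln (rdet (V x))) \<partial>lebesgue) < \<infinity>"
      by (rule nn_integral_ext_ln_finite[OF mw Q'(2)])
    have N: "(\<integral>\<^sup>+x\<in>Q. e2ennreal (- ext_ln (rdet (V x))) \<partial>lebesgue) < \<infinity>"
      by (rule ext_average_finite_imp[OF P Q'(3)]) (use \<open>E \<noteq> -\<infinity>\<close> in \<open>simp add: E_def\<close>)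
    note ext = ext_average_ext_ln[OF g Qs Q'(3) P N]
    define \<Lambda> where "\<Lambda> = (LINT x:Q|lebesgue. ln (rdet (V x)))"
    have "rdet M \<le> A * exp (\<Lambda> / \<mu>)"
      using E unfolding E_def ext(3) by (simp add: ext_exp_def average_def \<Lambda>_def \<mu>_def)
    then have "ln (rdet M) \<le> ln (A * exp (\<Lambda> / \<mu>))" using Mp by (intro ln_mono) auto
    then have "ln (rdet M) - ln A \<le> \<Lambda> / \<mu>" using A(1) by (simp add: ln_mult)
    then have \<Lambda>: "(ln (rdet M) - ln A) * \<mu> \<le> \<Lambda>" using \<mu> by (simp add: pos_le_divide_eq)
    define U where "U x = \<bar>ln K\<bar> + d * \<tau> x - (ln (rdet (V x)) - ln (rdet M))" for x
    have U0: "0 \<le> U x" if gp: "0 < rdet (V x)" for x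
    proof -
      have "rdet (V x) \<le> K * rdet M * \<tau> x ^ CARD('d)"
        using rdet_le_rtrace_compress[OF M C psd[OF mw], of x] by (simp add: K_def d_def \<tau>_def)
      moreover from this gp have "\<tau> x \<noteq> 0" by (auto simp: power_0_left)
      then have tp: "0 < \<tau> x" using \<tau>0[of x] by simp
      ultimately have "ln (rdet (V x)) \<le> ln (K * rdet M * \<tau> x ^ CARD('d))"
        using gp by (intro ln_mono) auto
      also have "\<dots> = ln K + ln (rdet M) + d * ln (\<tau> x)"
        using K Mp tp by (simp add: ln_mult ln_realpow d_def)
      also have "\<dots> \<le> \<bar>ln K\<bar> + ln (rdet M) + d * \<tau> x"
        using d ln_less_self[OF tp] by (intro add_mono mult_left_mono) auto
      finally show ?thesis by (simp add: U_def)
    qed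
    have const_i: "set_integrable lebesgue Q (\<lambda>x. c)" for c :: real
      by (rule set_integrable_const[OF Q'(1)])
    have const: "(LINT x:Q|lebesgue. c) = c * \<mu>" for c :: real
      unfolding \<mu>_def by (rule set_integral_const_mult[OF Q'(1)])
    have Ui: "set_integrable lebesgue Q U" "(LINT x:Q|lebesgue. U x)
        = \<bar>ln K\<bar> * \<mu> + d * (LINT x:Q|lebesgue. \<tau> x) - (\<Lambda> - ln (rdet M) * \<mu>)"
    proof -
      have d\<tau>: "set_integrable lebesgue Q (\<lambda>x. d * \<tau> x)" using \<tau>i by simp
      note a = set_integral_add[OF const_i[of "\<bar>ln K\<bar>"] d\<tau>]
      note b = set_integral_diff[OF ext(2) const_i[of "ln (rdet M)"]]
      show "set_integrable lebesgue Q U" unfolding U_def by (rule set_integral_diff(1)[OF a(1) b(1)])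
      show "(LINT x:Q|lebesgue. U x)
        = \<bar>ln K\<bar> * \<mu> + d * (LINT x:Q|lebesgue. \<tau> x) - (\<Lambda> - ln (rdet M) * \<mu>)"
        unfolding U_def set_integral_diff(2)[OF a(1) b(1)] a(2) b(2) by (simp add: const \<Lambda>_def)
    qed
    \<comment> \<open>\<open>U \<ge> 0\<close> is guaranteed only where \<open>det V > 0\<close>, that is almost everywhere; the absolute value makes \<open>h\<close> nonnegative everywhere.\<close>
    define h where "h x = \<bar>U x\<bar> + \<tau> x" for x
    have hm: "h \<in> borel_measurable lebesgue"
      unfolding h_def U_def using \<tau>m g(1) by measurable
    have h0: "0 \<le> h x" for x using \<tau>0[of x] by (simp add: h_def)
    have hi: "set_integrable lebesgue Q h"
      unfolding h_def by (intro set_integral_add(1) set_integrable_abs Ui(1) \<tau>i)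
    have hle: "(LINT x:Q|lebesgue. h x) \<le> R * \<mu>"
    proof -
      have "(LINT x:Q|lebesgue. \<bar>U x\<bar>) = (LINT x:Q|lebesgue. U x)"
        unfolding set_lebesgue_integral_def
      proof (rule integral_cong_AE)
        show "(\<lambda>x. indicator Q x *\<^sub>R \<bar>U x\<bar>) \<in> borel_measurable lebesgue"
          "(\<lambda>x. indicator Q x *\<^sub>R U x) \<in> borel_measurable lebesgue"
          using Ui(1) set_integrable_abs[OF Ui(1)] by (simp_all add: set_integrable_def borel_measurable_integrable)
        show "AE x in lebesgue. indicator Q x *\<^sub>R \<bar>U x\<bar> = indicator Q x *\<^sub>R U x"
          by (rule AE_mp[OF ext(1)], intro AE_I2) (use U0 in \<open>auto simp: indicator_def\<close>)
      qed
      then have "(LINT x:Q|lebesgue. h x) = (LINT x:Q|lebesgue. U x) + (LINT x:Q|lebesgue. \<tau> x)"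
        unfolding h_def using set_integral_add(2)[OF set_integrable_abs[OF Ui(1)] \<tau>i] by simp
      also have "\<dots> \<le> \<bar>ln K\<bar> * \<mu> + d * (d * \<mu>) + ln A * \<mu> + d * \<mu>"
      proof -
        have "d * (LINT x:Q|lebesgue. \<tau> x) \<le> d * (d * \<mu>)" using \<tau>avg d by (intro mult_left_mono) auto
        then show ?thesis using Ui(2) \<tau>avg \<Lambda>[unfolded left_diff_distrib] by linarith
      qed
      also have "\<dots> \<le> \<bar>ln K\<bar> * \<mu> + d * (d * \<mu>) + \<bar>ln A\<bar> * \<mu> + d * \<mu>"
        using \<mu> by (simp add: mult_right_mono)
      also have "\<dots> = R * \<mu>" by (simp add: R_def algebra_simps)
      finally show ?thesis .
    qed
    have bad: "measure lebesgue {x \<in> Q. s \<le> h x} \<le> \<epsilon> * \<mu>"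
    proof -
      have "s * measure lebesgue {x \<in> Q. s \<le> h x} \<le> R * \<mu>"
        using set_markov_inequality[OF hm h0 hi Q'(1), of s] s hle by simp
      also have "\<dots> = s * (\<epsilon> * \<mu>)" using \<epsilon> by (simp add: s_def)
      finally show ?thesis using s by simp
    qed
    define G where "G = {x \<in> Q. form_le ((exp (- s) / Z s) *\<^sub>R M) (V x)}"
    have Gm: "G \<in> lmeasurable" unfolding G_def by (rule form_le_set_measurable[OF mw Q'(1)])
    have good: "x \<in> G" if x: "x \<in> Q" "0 < rdet (V x)" "h x < s" for x
    proof -
      have \<tau>s: "\<tau> x \<le> s" and Us: "U x < s" using x(3) \<tau>0[of x] by (auto simp: h_def)
      have "- s \<le> ln (rdet (V x)) - ln (rdet M)"
        using Us d \<tau>0[of x] unfolding U_def by (smt (verit) mult_nonneg_nonneg)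
      also have "\<dots> = ln (rdet (V x) / rdet M)" using x(2) Mp by (simp add: ln_div)
      finally have "exp (- s) \<le> exp (ln (rdet (V x) / rdet M))" by simp
      then have e: "exp (- s) \<le> rdet (V x) / rdet M" using x(2) Mp by simp
      have le: "form_le ((rdet (V x) / rdet M / Z s) *\<^sub>R M) (V x)"
        using form_le_of_rdet[OF M C psd[OF mw] x(2) _ s] \<tau>s by (simp add: Z_def d_def \<tau>_def)
      have "form_le ((exp (- s) / Z s) *\<^sub>R M) (V x)"
        unfolding form_le_def
      proof
        fix v
        have "0 \<le> v \<bullet> (M *v v)" using pos_def_imp_psd[OF M] by (simp add: pos_semidef_def)
        then have "exp (- s) / Z s * (v \<bullet> (M *v v)) \<le> rdet (V x) / rdet M / Z s * (v \<bullet> (M *v v))"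
          using e Z[OF s] by (intro mult_right_mono divide_right_mono) auto
        also have "\<dots> \<le> v \<bullet> (V x *v v)" using le by (simp add: form_le_def scaleR_mv)
        finally show "v \<bullet> ((exp (- s) / Z s) *\<^sub>R M *v v) \<le> v \<bullet> (V x *v v)" by (simp add: scaleR_mv)
      qed
      then show ?thesis using x(1) by (simp add: G_def)
    qed
    define H where "H = {x \<in> Q. s \<le> h x}"
    have Hm: "H \<in> lmeasurable" unfolding H_def by (rule lmeasurable_ge_set[OF hm Q'(1)])
    have "\<mu> \<le> measure lebesgue (G \<union> H)"
    proof -
      have "AE x in lebesgue. x \<in> Q \<longrightarrow> x \<in> G \<union> H"
        by (rule AE_mp[OF ext(1)], intro AE_I2) (use good in \<open>force simp: H_def not_le\<close>)
      then have "emeasure lebesgue Q \<le> emeasure lebesgue (G \<union> H)"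
        by (rule emeasure_mono_AE) (use Gm Hm in \<open>auto simp: fmeasurableD\<close>)
      then show ?thesis
        using fmeasurable.Un[OF Gm Hm] Q'(1) by (simp add: emeasure_eq_measure2 \<mu>_def)
    qed
    also have "\<dots> \<le> measure lebesgue G + measure lebesgue H"
      by (rule measure_Un_le) (use Gm Hm in \<open>auto simp: fmeasurableD\<close>)
    finally have "(1 - \<epsilon>) * \<mu> \<le> measure lebesgue G" using bad by (simp add: H_def algebra_simps)
    then show ?thesis by (simp add: G_def s_def M_def \<mu>_def)
  qed
  show ?thesis
    unfolding class_Ainf_def
  proof (intro allI impI)
    fix \<epsilon> :: real assume \<epsilon>: "0 < \<epsilon>"
    have "0 < exp (- (R / \<epsilon>)) / Z (R / \<epsilon>)" using R \<epsilon> Z by simp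
    then show "\<exists>\<delta>>0. \<forall>Q. cube Q \<longrightarrow> (1 - \<epsilon>) * measure lebesgue Q
        \<le> measure lebesgue {x \<in> Q. form_le (\<delta> *\<^sub>R average Q V) (V x)}"
      using main[OF \<epsilon>] by blast
  qed
qed

end

theorem propositionB18:
  fixes V :: "real^'n \<Rightarrow> complex^'d^'d"
  assumes "matrix_weight V"
    and "class_ND V"
  shows "(class_A2inf V \<longleftrightarrow> class_Ainf V) \<and>
         (class_Ainf V \<longleftrightarrow>
            class_RBM V \<and> scalar_Ainf (\<lambda>x. rdet (V x) powr (1 / CARD('d))))"
  using A2inf_imp_Ainf[OF assms] Ainf_imp_RBM_and_scalar_Ainf[OF assms]
    RBM_and_scalar_Ainf_imp_A2inf[OF assms] by blast

end
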